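(* Let $P\subset\mathbb{R}^3$ be a lattice polytope and let $Z$ be a smallest maximal decomposition in $P$. Then, for some non-negative integers $n_1,\dots,n_7$, $Z$ is $\mathrm{AGL}(3,\mathbb{Z})$-equivalent either to $$n_1[0,e_1]+n_2[0,e_2]+n_3[0,e_1+e_2+2e_3]+n_4[0,e_1+e_2+e_3]+n_5[0,e_1+e_3]+n_6[0,e_2+e_3]+n_7[0,e_3]$$ or to $$n_1[0,e_1]+n_2[0,e_2]+n_3[0,e_3]+n_4[0,e_1+e_2+e_3]+n_5[0,e_1\pm e_2]+n_6[0,e_1+e_3]+n_7[0,e_2+e_3],$$ where in the second form one choice of the sign $\pm$ is made.
   Context: A lattice polytope in $\mathbb{R}^n$ is the convex hull of a finite non-empty set of points of $\mathbb{Z}^n$; it is non-trivial if it is not a single point. A lattice segment is primitive if its only lattice points are its two endpoints. The Minkowski sum of $P,Q\subset\mathbb{R}^n$ is $P+Q=\{p+q : p\in P, q\in Q\}$, and $nE$ denotes the Minkowski sum of $n$ copies of $E$ (with $0E=\{0\}$). The Minkowski length $L(P)$ of a lattice polytope $P\subset\mathbb{R}^n$ is the largest number $L$ of primitive lattice segments $E_1,\dots,E_L$ in $\mathbb{R}^n$ (not necessarily distinct) such that $E_1+\cdots+E_L\subseteq P$; equivalently, it is the largest number of non-trivial lattice polytopes whose Minkowski sum is contained in $P$. A maximal decomposition in $P$ is a Minkowski sum $A+Q_1+\cdots+Q_L\subseteq P$ with $A\in\mathbb{Z}^n$ and $L=L(P)$ non-trivial lattice polytopes $Q_i$. Maximal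 decompositions in $P$ are partially ordered by inclusion of their Minkowski sums (as subsets of $\mathbb{R}^n$), and a smallest maximal decomposition is one that is minimal for this partial order, i.e. whose Minkowski sum does not strictly contain the Minkowski sum of another maximal decomposition in $P$. $\mathrm{AGL}(n,\mathbb{Z})$ is the group of affine unimodular transformations $x\mapsto Mx+v$ with $M\in\mathrm{GL}(n,\mathbb{Z})$, $v\in\mathbb{Z}^n$; two polytopes are $\mathrm{AGL}(n,\mathbb{Z})$-equivalent if one is the image of the other under such a map. $e_1,e_2,e_3$ is the standard basis of $\mathbb{R}^3$, and $[0,v]$ is the segment from the origin to $v$. *)

theory Defs
  imports "HOL-Analysis.Analysis"
begin

definition integer_lattice :: "(real ^ 'n) set" where
  "integer_lattice = {x. \<forall>i. x $ i \<in> \<int>}"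

definition lattice_polytope :: "(real ^ 'n) set \<Rightarrow> bool" where
  "lattice_polytope P \<longleftrightarrow>
     (\<exists>S. finite S \<and> S \<noteq> {} \<and> S \<subseteq> integer_lattice \<and> P = convex hull S)"

definition nontrivial_lattice_polytope :: "(real ^ 'n) set \<Rightarrow> bool" where
  "nontrivial_lattice_polytope P \<longleftrightarrow> lattice_polytope P \<and> (\<nexists>x. P = {x})"

definition primitive_segment :: "(real ^ 'n) set \<Rightarrow> bool" where
  "primitive_segment E \<longleftrightarrow>
     (\<exists>a b. a \<in> integer_lattice \<and> b \<in> integer_lattice \<and> a \<noteq> b \<and>
        E = closed_segment a b \<and> E \<inter> integer_lattice = {a, b})"

(* Addition of sets is the Minkowski sum and 0 is the set consisting of the origin
   (HOL-Library.Set_Algebras), so sum_list and sum on sets are iterated Minkowski sums. *)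

definition minkowski_multiple :: "nat \<Rightarrow> (real ^ 'n) set \<Rightarrow> (real ^ 'n) set"
    (infixr "\<odot>" 75) where
  "n \<odot> E = (\<Sum>i<n. E)"

(* For a lattice polytope this set of numbers is finite, so the supremum is its maximum.
   If P is a lattice point other than the origin, the set is empty (even the empty sum 0
   does not lie in P) and the supremum on nat yields the intended value 0. *)
definition minkowski_length :: "(real ^ 'n) set \<Rightarrow> nat" where
  "minkowski_length P =
     Sup {length Es | Es. (\<forall>E \<in> set Es. primitive_segment E) \<and> sum_list Es \<subseteq> P}"

definition decomposition_sum :: "real ^ 'n \<Rightarrow> (real ^ 'n) set list \<Rightarrow> (real ^ 'n) set" where
  "decomposition_sum A Qs = {A} + sum_list Qs"

definition maximal_decomposition ::
    "(real ^ 'n) set \<Rightarrow> real ^ 'n \<Rightarrow> (real ^ 'n) set list \<Rightarrow> bool" where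
  "maximal_decomposition P A Qs \<longleftrightarrow>
     A \<in> integer_lattice \<and> length Qs = minkowski_length P \<and>
     (\<forall>Q \<in> set Qs. nontrivial_lattice_polytope Q) \<and> decomposition_sum A Qs \<subseteq> P"

definition smallest_maximal_decomposition ::
    "(real ^ 'n) set \<Rightarrow> real ^ 'n \<Rightarrow> (real ^ 'n) set list \<Rightarrow> bool" where
  "smallest_maximal_decomposition P A Qs \<longleftrightarrow>
     maximal_decomposition P A Qs \<and>
     \<not> (\<exists>B Rs. maximal_decomposition P B Rs \<and> decomposition_sum B Rs \<subset> decomposition_sum A Qs)"

(* Invertibility of M is over int, i.e. M is in GL(n,Z). *)
definition affine_unimodular :: "(real ^ 'n \<Rightarrow> real ^ 'n) \<Rightarrow> bool" where
  "affine_unimodular f \<longleftrightarrow>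
     (\<exists>(M :: int ^ 'n ^ 'n) v. invertible M \<and> v \<in> integer_lattice \<and>
        f = (\<lambda>x. map_matrix real_of_int M *v x + v))"

definition AGL_equivalent :: "(real ^ 'n) set \<Rightarrow> (real ^ 'n) set \<Rightarrow> bool" where
  "AGL_equivalent P Q \<longleftrightarrow> (\<exists>f. affine_unimodular f \<and> f ` P = Q)"

abbreviation e1 :: "real ^ 3" where "e1 \<equiv> axis 1 1"
abbreviation e2 :: "real ^ 3" where "e2 \<equiv> axis 2 1"
abbreviation e3 :: "real ^ 3" where "e3 \<equiv> axis 3 1"

end

theory Submission
  imports Defs
begin

text \<open>By minimality \<open>Z\<close> is a translate of a sum of lattice segments, and no sum of equally many
  lattice segments lies strictly inside the sum of some of them. If the parallelogram spanned by two
  of them contained a lattice point \<open>p\<close> other than its vertices, the segments \<open>[0, p]\<close> and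
  \<open>[0, a + b - p]\<close> would span a strictly smaller one; so \<open>a, b\<close> generate all lattice points in their
  plane. If the parallelepiped spanned by three of them contained two lattice points \<open>p \<noteq> q\<close> other
  than its vertices, then, for a suitable pair of opposite vertices \<open>s, s'\<close>, the steps of the path
  \<open>s, p, q, s'\<close> would span a strictly smaller one; so independent \<open>a, b, c\<close> either form a lattice
  basis or generate a sublattice of index 2 with \<open>(a + b + c) / 2\<close> as the missing coset. An index-2
  triple leaves only \<open>a, b, c\<close> and \<open>(\<plusminus>a \<plusminus> b \<plusminus> c) / 2\<close> as possible directions, which is the first
  form. Otherwise all directions have coordinates \<open>0, \<plusminus>1\<close> in a basis chosen among them and are
  distinct modulo 2, which leads to the second form.\<close>

subsection \<open>Lattice zonotopes\<close>

lemma integer_lattice_0 [simp]: "0 \<in> integer_lattice"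
  by (simp add: integer_lattice_def)

lemma integer_lattice_add [simp]:
  "x \<in> integer_lattice \<Longrightarrow> y \<in> integer_lattice \<Longrightarrow> x + y \<in> integer_lattice"
  by (simp add: integer_lattice_def)

lemma integer_lattice_uminus [simp]: "- x \<in> integer_lattice \<longleftrightarrow> x \<in> integer_lattice"
  using minus_in_Ints_iff by (fastforce simp: integer_lattice_def)

lemma integer_lattice_diff [simp]:
  "x \<in> integer_lattice \<Longrightarrow> y \<in> integer_lattice \<Longrightarrow> x - y \<in> integer_lattice"
  by (simp add: integer_lattice_def)

lemma integer_lattice_scaleR [simp]:
  "r \<in> \<int> \<Longrightarrow> x \<in> integer_lattice \<Longrightarrow> r *\<^sub>R x \<in> integer_lattice"
  by (simp add: integer_lattice_def)

lemma integer_lattice_axis [simp]: "axis i 1 \<in> integer_lattice"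
  by (simp add: integer_lattice_def axis_def)

text \<open>Every generator starts at the origin; translations are carried separately as
  \<open>{t} + zonotope vs\<close>.\<close>

definition zonotope :: "(real ^ 'n) list \<Rightarrow> (real ^ 'n) set" where
  "zonotope vs = (\<Sum>v\<leftarrow>vs. closed_segment 0 v)"

lemma zonotope_Nil [simp]: "zonotope [] = {0}"
  by (simp add: zonotope_def)

lemma zonotope_Cons [simp]: "zonotope (v # vs) = closed_segment 0 v + zonotope vs"
  by (simp add: zonotope_def)

lemma zonotope_append [simp]: "zonotope (us @ vs) = zonotope us + zonotope vs"
  by (simp add: zonotope_def)

lemma zonotope_mset_eq: "mset us = mset vs \<Longrightarrow> zonotope us = zonotope vs"
  unfolding zonotope_def by (metis mset_map sum_mset_sum_list)

lemma singleton_plus_singleton [simp]: "{a} + ({b} + X) = {a + b} + (X :: 'a::monoid_add set)"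
  unfolding add.assoc[symmetric] by (simp add: set_plus_def)

lemma mem_singleton_plus: "x \<in> {a} + X \<longleftrightarrow> x - a \<in> (X :: 'a::ab_group_add set)"
  by (force simp: set_plus_def algebra_simps)

lemma mem_closed_segment_0: "x \<in> closed_segment 0 v \<longleftrightarrow> (\<exists>r. 0 \<le> r \<and> r \<le> 1 \<and> x = r *\<^sub>R v)"
  by (auto simp: in_segment)

text \<open>Reversing a generator only translates the zonotope, so generators matter only up to
  sign.\<close>

lemma closed_segment_0_uminus: "closed_segment 0 (- v) = {- v} + closed_segment 0 v"
proof -
  have "{- v} + closed_segment 0 v = closed_segment (- v + 0) (- v + v)"
    unfolding closed_segment_translation by (auto simp: set_plus_def)
  then show ?thesis
    by (simp add: closed_segment_commute)
qed

lemma closed_segment_eq_translate: "closed_segment x y = {x} + closed_segment 0 (y - x)"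
proof -
  have "{x} + closed_segment 0 (y - x) = closed_segment (x + 0) (x + (y - x))"
    unfolding closed_segment_translation by (auto simp: set_plus_def)
  then show ?thesis
    by simp
qed

lemma mem_segment_plus:
  "x \<in> closed_segment 0 v + X \<longleftrightarrow> (\<exists>r. 0 \<le> r \<and> r \<le> 1 \<and> x - r *\<^sub>R v \<in> X)"
proof
  assume "x \<in> closed_segment 0 v + X"
  then show "\<exists>r. 0 \<le> r \<and> r \<le> 1 \<and> x - r *\<^sub>R v \<in> X"
    by (elim set_plus_elim) (force simp: mem_closed_segment_0)
next
  assume "\<exists>r. 0 \<le> r \<and> r \<le> 1 \<and> x - r *\<^sub>R v \<in> X"
  then obtain r where "r *\<^sub>R v \<in> closed_segment 0 v" "x - r *\<^sub>R v \<in> X"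
    by (auto simp: mem_closed_segment_0)
  then have "r *\<^sub>R v + (x - r *\<^sub>R v) \<in> closed_segment 0 v + X"
    by (rule set_plus_intro)
  then show "x \<in> closed_segment 0 v + X"
    by simp
qed

lemma mem_zonotope_Cons:
  "x \<in> zonotope (v # vs) \<longleftrightarrow> (\<exists>r. 0 \<le> r \<and> r \<le> 1 \<and> x - r *\<^sub>R v \<in> zonotope vs)"
  unfolding zonotope_Cons mem_segment_plus ..

lemma linear_image_zonotope:
  assumes "linear f"
  shows "f ` zonotope vs = zonotope (map f vs)"
proof (induction vs)
  case Nil
  show ?case using assms by (simp add: linear_0)
next
  case (Cons v vs)
  have "f ` (A + B) = f ` A + f ` B" for A B
    using assms by (force simp: set_plus_def linear_add image_iff)
  with Cons assms show ?case
    by (simp add: closed_segment_linear_image[symmetric] linear_0)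
qed

section \<open>Widths as the test for strict inclusion\<close>

text \<open>For linear \<open>f\<close> this is the maximum minus the minimum of \<open>f\<close> on
  \<open>zonotope vs\<close>. It is additive in the list, which makes it a convenient
  invariant.\<close>

definition width :: "(real ^ 'n \<Rightarrow> real) \<Rightarrow> (real ^ 'n) list \<Rightarrow> real" where
  "width f vs = (\<Sum>v\<leftarrow>vs. \<bar>f v\<bar>)"

lemma width_simps [simp]:
  "width f [] = 0" "width f (v # vs) = \<bar>f v\<bar> + width f vs"
  "width f (us @ vs) = width f us + width f vs"
  by (simp_all add: width_def)

lemma width_upper:
  assumes "linear f" "x \<in> zonotope vs" "y \<in> zonotope vs"
  shows "f x - f y \<le> width f vs"
  using assms(2,3)
proof (induction vs arbitrary: x y)
  case (Cons v vs)
  from Cons.prems obtain r s x' y' where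
    *: "0 \<le> r" "r \<le> 1" "0 \<le> s" "s \<le> 1" "x' \<in> zonotope vs" "y' \<in> zonotope vs"
      "x = r *\<^sub>R v + x'" "y = s *\<^sub>R v + y'"
    by (auto simp: set_plus_def mem_closed_segment_0)
  have "f x - f y = (r - s) * f v + (f x' - f y')"
    using assms(1) * by (simp add: linear_add linear_scale algebra_simps)
  moreover have "(r - s) * f v \<le> \<bar>r - s\<bar> * \<bar>f v\<bar>"
    by (metis abs_ge_self abs_mult)
  moreover have "\<bar>r - s\<bar> * \<bar>f v\<bar> \<le> 1 * \<bar>f v\<bar>"
    using * by (intro mult_right_mono) auto
  ultimately show ?case
    using Cons.IH[OF *(5,6)] by simp
qed simp

lemma width_attained:
  assumes "linear f"
  shows "\<exists>x \<in> zonotope vs. \<exists>y \<in> zonotope vs. f x - f y = width f vs"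
proof (induction vs)
  case (Cons v vs)
  then obtain x y where xy: "x \<in> zonotope vs" "y \<in> zonotope vs" "f x - f y = width f vs"
    by blast
  have mem: "0 + z \<in> zonotope (v # vs)" "v + z \<in> zonotope (v # vs)" if "z \<in> zonotope vs" for z
    using that by (auto simp only: zonotope_Cons intro!: set_plus_intro ends_in_segment)
  show ?case
  \<comment> \<open>The generator \<open>v\<close> is added to the maximizing point if
    \<open>f v\<close> is nonnegative and to the minimizing point otherwise.\<close>
  proof (cases "f v \<ge> 0")
    case True
    then have "f (v + x) - f (0 + y) = width f (v # vs)"
      using assms xy by (simp add: linear_add)
    then show ?thesis using mem xy by blast
  next
    case False
    then have "f (0 + x) - f (v + y) = width f (v # vs)"
      using assms xy by (simp add: linear_add)
    then show ?thesis using mem xy by blast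
  qed
qed simp

text \<open>The width depends only on the set up to translation, not on the chosen generators; two
  lists with equal zonotopes therefore have equal widths.\<close>

lemma width_mono:
  assumes "linear f" "{s} + zonotope us \<subseteq> {t} + zonotope vs"
  shows "width f us \<le> width f vs"
proof -
  obtain x y where xy: "x \<in> zonotope us" "y \<in> zonotope us" "f x - f y = width f us"
    using width_attained[OF assms(1)] by blast
  have "s + x \<in> {t} + zonotope vs" "s + y \<in> {t} + zonotope vs"
    using assms(2) xy by (auto simp: subset_iff set_plus_def)
  then have "f (s + x - t) - f (s + y - t) \<le> width f vs"
    using width_upper[OF assms(1)] by (simp add: mem_singleton_plus)
  then show ?thesis
    using assms(1) xy by (simp add: linear_add linear_diff)
qed

text \<open>The property of the segments of a smallest maximal decomposition that survives
  forgetting the ambient polytope.\<close>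

definition tight :: "(real ^ 'n) list \<Rightarrow> bool" where
  "tight vs \<longleftrightarrow> set vs \<subseteq> integer_lattice - {0} \<and>
     (\<forall>us t. set us \<subseteq> integer_lattice - {0} \<longrightarrow> length us = length vs \<longrightarrow> t \<in> integer_lattice \<longrightarrow>
        {t} + zonotope us \<subseteq> zonotope vs \<longrightarrow> {t} + zonotope us = zonotope vs)"

lemma tight_translate:
  assumes "tight vs" "length us = length vs" "set us \<subseteq> integer_lattice - {0}"
    "t \<in> integer_lattice" "zonotope vs = {t} + zonotope us"
  shows "tight us"
  unfolding tight_def
proof (intro conjI allI impI)
  fix ws s
  assume ws: "set ws \<subseteq> integer_lattice - {0}" "length ws = length us" "s \<in> integer_lattice"
    "{s} + zonotope ws \<subseteq> zonotope us"
  have "{t + s} + zonotope ws \<subseteq> zonotope vs"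
    using set_plus_mono2[OF subset_refl ws(4), of "{t}"] assms(5) by simp
  then have "{t + s} + zonotope ws = zonotope vs"
    using assms(1,2,4) ws unfolding tight_def by simp
  then have "{- t} + ({t + s} + zonotope ws) = {- t} + ({t} + zonotope us)"
    using assms(5) by simp
  then show "{s} + zonotope ws = zonotope us"
    by simp
qed (use assms in auto)

text \<open>Adding \<open>rest\<close> to both sides keeps the inclusion, tightness turns it into an
  equality, and additivity of widths cancels \<open>rest\<close> again. A replacement inside
  \<open>zonotope vs\<close> that changes a single width is thus impossible; all later
  contradictions arise this way.\<close>

lemma tight_exchange:
  assumes "tight (vs @ rest)" "set us \<subseteq> integer_lattice - {0}" "length us = length vs"
    "t \<in> integer_lattice" "{t} + zonotope us \<subseteq> zonotope vs" "linear f"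
  shows "width f us = width f vs"
proof -
  have "{t} + zonotope (us @ rest) \<subseteq> zonotope (vs @ rest)"
    using set_plus_mono2[OF assms(5) subset_refl, of "zonotope rest"] by (simp add: add.assoc)
  moreover have "set (us @ rest) \<subseteq> integer_lattice - {0}"
    using assms(1,2) by (auto simp: tight_def)
  moreover have "length (us @ rest) = length (vs @ rest)"
    using assms(3) by simp
  ultimately have eq: "{t} + zonotope (us @ rest) = {0} + zonotope (vs @ rest)"
    using assms(1,4) unfolding tight_def set_add_0 by blast
  have "width f (us @ rest) = width f (vs @ rest)"
    using width_mono[OF assms(6) equalityD1[OF eq]] width_mono[OF assms(6) equalityD2[OF eq]]
    by linarith
  then show ?thesis
    by simp
qed

section \<open>Moving chosen directions to the front\<close>

definition directions :: "(real ^ 'n) list \<Rightarrow> (real ^ 'n) set" where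
  "directions vs = set vs \<union> uminus ` set vs"

lemma uminus_mem_directions [simp]: "- v \<in> directions vs \<longleftrightarrow> v \<in> directions vs"
  by (force simp: directions_def)

lemma tight_directions: "tight vs \<Longrightarrow> directions vs \<subseteq> integer_lattice - {0}"
  by (auto simp: tight_def directions_def)

lemma zonotope_extract:
  assumes "v \<in> directions vs" "set vs \<subseteq> integer_lattice"
  shows "\<exists>rest t. t \<in> integer_lattice \<and> length vs = Suc (length rest) \<and> set rest \<subseteq> set vs \<and>
    directions vs = directions (v # rest) \<and> zonotope vs = {t} + zonotope (v # rest)"
proof -
  obtain w where w: "w \<in> set vs" "v = w \<or> v = - w"
    using assms(1) by (auto simp: directions_def)
  define rest where "rest = remove1 w vs"
  have ms: "mset vs = mset (w # rest)"
    using w by (simp add: rest_def)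
  have "set vs = set (w # rest)"
    using ms by (metis set_mset_mset)
  moreover have "length vs = Suc (length rest)"
    using ms by (metis length_Cons size_mset)
  moreover have "zonotope vs = zonotope (w # rest)"
    using ms by (rule zonotope_mset_eq)
  \<comment> \<open>If \<open>v = - w\<close>, reversing the segment costs the translation by
    \<open>w\<close>.\<close>
  moreover have "closed_segment 0 w = {if v = w then 0 else w} + closed_segment 0 v"
    using w closed_segment_0_uminus[of "- w"] by auto
  ultimately show ?thesis
    using w assms(2)
    by (intro exI[of _ rest] exI[of _ "if v = w then 0 else w"])
       (auto simp: directions_def add.assoc)
qed

text \<open>The entries of \<open>ds\<close> are pairwise neither equal nor opposite, so extracting
  one of them, which may use up its only occurrence, leaves the others available.\<close>

lemma zonotope_extract_list:
  assumes "sorted_wrt (\<lambda>a b. a \<noteq> b \<and> a \<noteq> - b) ds" "set ds \<subseteq> directions vs"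
    "set vs \<subseteq> integer_lattice"
  shows "\<exists>rest t. t \<in> integer_lattice \<and> length vs = length (ds @ rest) \<and> set rest \<subseteq> set vs \<and>
    zonotope vs = {t} + zonotope (ds @ rest)"
  using assms
proof (induction ds arbitrary: vs)
  case Nil
  show ?case
    by (rule exI[of _ vs], rule exI[of _ 0]) simp
next
  case (Cons d ds)
  have "d \<in> directions vs"
    using Cons.prems by simp
  then obtain rest t where rest: "t \<in> integer_lattice" "length vs = Suc (length rest)"
    "set rest \<subseteq> set vs" "directions vs = directions (d # rest)"
    "zonotope vs = {t} + zonotope (d # rest)"
    using zonotope_extract[OF _ Cons.prems(3)] by blast
  have "set ds \<subseteq> directions rest"
  proof
    fix x assume "x \<in> set ds"
    then have "x \<in> directions (d # rest)" "d \<noteq> x" "d \<noteq> - x"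
      using Cons.prems rest by auto
    then show "x \<in> directions rest"
      by (auto simp: directions_def)
  qed
  moreover have "set rest \<subseteq> integer_lattice" "sorted_wrt (\<lambda>a b. a \<noteq> b \<and> a \<noteq> - b) ds"
    using Cons.prems rest by auto
  ultimately obtain rest' t' where rest': "t' \<in> integer_lattice" "length rest = length (ds @ rest')"
    "set rest' \<subseteq> set rest" "zonotope rest = {t'} + zonotope (ds @ rest')"
    using Cons.IH by blast
  have "zonotope vs = {t + t'} + zonotope ((d # ds) @ rest')"
    unfolding rest(5) zonotope_Cons rest'(4) append_Cons
    by (simp only: add.left_commute[of "closed_segment 0 d"] singleton_plus_singleton)
  then show ?case
    using rest rest' by (intro exI[of _ rest'] exI[of _ "t + t'"]) auto
qed

text \<open>Brings chosen directions, with chosen signs, into the position that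
  \<open>tight_exchange\<close> requires.\<close>

lemma tight_extract:
  assumes "tight vs" "sorted_wrt (\<lambda>a b. a \<noteq> b \<and> a \<noteq> - b) ds" "set ds \<subseteq> directions vs"
  shows "\<exists>rest. tight (ds @ rest)"
proof -
  have vs: "set vs \<subseteq> integer_lattice - {0}"
    using assms(1) by (simp add: tight_def)
  then obtain rest t where "t \<in> integer_lattice" "length vs = length (ds @ rest)"
    "set rest \<subseteq> set vs" "zonotope vs = {t} + zonotope (ds @ rest)"
    using zonotope_extract_list[OF assms(2,3)] by blast
  then have "tight (ds @ rest)"
    using assms(1,3) vs tight_directions[OF assms(1)] by (intro tight_translate[OF assms(1)]) auto
  then show ?thesis ..
qed

subsection \<open>Smallest maximal decompositions\<close>

lemma nontrivial_segment:
  assumes "v \<in> integer_lattice" "v \<noteq> 0"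
  shows "nontrivial_lattice_polytope (closed_segment 0 v)"
  unfolding nontrivial_lattice_polytope_def lattice_polytope_def
proof
  show "\<exists>S. finite S \<and> S \<noteq> {} \<and> S \<subseteq> integer_lattice \<and> closed_segment 0 v = convex hull S"
    using assms by (intro exI[of _ "{0, v}"]) (auto simp: segment_convex_hull)
  have "0 \<in> closed_segment 0 v" "v \<in> closed_segment 0 v"
    by simp_all
  then show "\<nexists>x. closed_segment 0 v = {x}"
    using assms(2) by (metis singletonD)
qed

lemma nontrivial_polytope_contains_segment:
  assumes "nontrivial_lattice_polytope Q"
  shows "\<exists>x v. x \<in> integer_lattice \<and> v \<in> integer_lattice - {0} \<and> {x} + closed_segment 0 v \<subseteq> Q"
proof -
  obtain S where S: "finite S" "S \<noteq> {}" "S \<subseteq> integer_lattice" "Q = convex hull S"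
    and nontriv: "\<nexists>x. Q = {x}"
    using assms unfolding nontrivial_lattice_polytope_def lattice_polytope_def by blast
  obtain x where x: "x \<in> S" using S by blast
  have "S \<noteq> {x}"
    using nontriv S(4) by auto
  then obtain y where y: "y \<in> S" "y \<noteq> x"
    using x by blast
  have "closed_segment x y \<subseteq> Q"
    using S(4) x y hull_inc[of _ S convex] by (simp add: closed_segment_subset)
  then show ?thesis
    using x y S(3)
    by - (rule exI[of _ x], rule exI[of _ "y - x"], auto intro!: integer_lattice_diff simp: closed_segment_eq_translate[symmetric])
qed

lemma decomposition_contains_zonotope:
  assumes "\<forall>Q \<in> set Qs. nontrivial_lattice_polytope Q"
  shows "\<exists>x vs. x \<in> integer_lattice \<and> set vs \<subseteq> integer_lattice - {0} \<and> length vs = length Qs \<and>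
    {x} + zonotope vs \<subseteq> sum_list Qs"
  using assms
proof (induction Qs)
  case Nil
  show ?case by (rule exI[of _ 0], rule exI[of _ "[]"]) simp
next
  case (Cons Q Qs)
  then obtain x vs where *: "x \<in> integer_lattice" "set vs \<subseteq> integer_lattice - {0}"
    "length vs = length Qs" "{x} + zonotope vs \<subseteq> sum_list Qs"
    by auto
  obtain y v where **: "y \<in> integer_lattice" "v \<in> integer_lattice - {0}" "{y} + closed_segment 0 v \<subseteq> Q"
    using Cons.prems nontrivial_polytope_contains_segment[of Q] by auto
  have "({y} + closed_segment 0 v) + ({x} + zonotope vs) \<subseteq> Q + sum_list Qs"
    using * ** by (intro set_plus_mono2)
  moreover have "({y} + closed_segment 0 v) + ({x} + zonotope vs) = {y + x} + zonotope (v # vs)"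
    by (simp only: zonotope_Cons add.assoc add.left_commute[of "closed_segment 0 v"] singleton_plus_singleton)
  ultimately show ?case
    using * ** by (intro exI[of _ "y + x"] exI[of _ "v # vs"]) auto
qed

text \<open>Each summand contains a lattice segment, and the sum of these segments is again a
  maximal decomposition, so by minimality it fills the whole sum. The same minimality, applied to
  any competing list of generators, gives tightness.\<close>

lemma smallest_decomposition_is_tight_zonotope:
  assumes "smallest_maximal_decomposition P A Qs"
  shows "\<exists>t vs. t \<in> integer_lattice \<and> tight vs \<and> decomposition_sum A Qs = {t} + zonotope vs"
proof -
  have max: "maximal_decomposition P A Qs"
    and min: "\<And>B Rs. maximal_decomposition P B Rs \<Longrightarrow>
      \<not> decomposition_sum B Rs \<subset> decomposition_sum A Qs"
    using assms by (auto simp: smallest_maximal_decomposition_def)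
  have A: "A \<in> integer_lattice" "length Qs = minkowski_length P" "decomposition_sum A Qs \<subseteq> P"
    "\<forall>Q \<in> set Qs. nontrivial_lattice_polytope Q"
    using max by (auto simp: maximal_decomposition_def)
  \<comment> \<open>A zonotope with the right number of generators inside the decomposition is
    itself a maximal decomposition in \<open>P\<close>, hence not strictly smaller.\<close>
  have eq: "{t} + zonotope us = decomposition_sum A Qs"
    if "t \<in> integer_lattice" "set us \<subseteq> integer_lattice - {0}" "length us = length Qs"
      "{t} + zonotope us \<subseteq> decomposition_sum A Qs" for t us
  proof -
    have d: "decomposition_sum t (map (closed_segment 0) us) = {t} + zonotope us"
      by (simp add: decomposition_sum_def zonotope_def)
    then have "maximal_decomposition P t (map (closed_segment 0) us)"
      using that A unfolding maximal_decomposition_def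
      by (auto intro!: nontrivial_segment)
    then show ?thesis
      using min d that(4) by (metis psubsetI)
  qed
  obtain x vs where x: "x \<in> integer_lattice" "set vs \<subseteq> integer_lattice - {0}"
    "length vs = length Qs" "{x} + zonotope vs \<subseteq> sum_list Qs"
    using decomposition_contains_zonotope A(4) by blast
  have "{A + x} + zonotope vs \<subseteq> decomposition_sum A Qs"
    using set_plus_mono2[OF subset_refl x(4), of "{A}"] by (simp add: decomposition_sum_def)
  then have Z: "{A + x} + zonotope vs = decomposition_sum A Qs"
    using eq x A by simp
  have "tight vs"
    unfolding tight_def
  proof (intro conjI allI impI)
    fix us t
    assume us: "set us \<subseteq> integer_lattice - {0}" "length us = length vs" "t \<in> integer_lattice"
      "{t} + zonotope us \<subseteq> zonotope vs"
    have "{A + x + t} + zonotope us \<subseteq> decomposition_sum A Qs"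
      using set_plus_mono2[OF subset_refl us(4), of "{A + x}"] by (simp add: Z[symmetric])
    then have "{A + x + t} + zonotope us = {A + x} + zonotope vs"
      using eq[of "A + x + t" us] us x A Z by simp
    then have "{- (A + x)} + ({A + x + t} + zonotope us) = {- (A + x)} + ({A + x} + zonotope vs)"
      by simp
    then show "{t} + zonotope us = zonotope vs"
      by simp
  qed (fact x(2))
  then show ?thesis
    using Z x A by (intro exI[of _ "A + x"] exI[of _ vs]) auto
qed

text \<open>A non-integral \<open>r\<close> would make \<open>frac r *\<^sub>R v\<close> a shorter
  lattice vector on the same segment; exchanging it for \<open>v\<close> shrinks the width along
  \<open>v\<close>.\<close>

lemma tight_primitive:
  assumes "tight vs" "v \<in> directions vs" "r *\<^sub>R v \<in> integer_lattice"
  shows "r \<in> \<int>"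
proof (rule ccontr)
  assume "r \<notin> \<int>"
  then have r: "0 < frac r" "frac r < 1"
    by (simp_all add: frac_lt_1 frac_gt_0_iff)
  have v: "v \<in> integer_lattice" "v \<noteq> 0"
    using assms tight_directions by auto
  define x where "x = frac r *\<^sub>R v"
  have "x = r *\<^sub>R v - of_int \<lfloor>r\<rfloor> *\<^sub>R v"
    by (simp add: x_def frac_def scaleR_diff_left)
  then have x: "x \<in> integer_lattice"
    using assms(3) v by simp
  obtain rest where "tight ([v] @ rest)"
    using tight_extract[OF assms(1), of "[v]"] assms(2) by auto
  moreover have "{0} + zonotope [x] \<subseteq> zonotope [v]"
  proof
    fix z assume "z \<in> {0} + zonotope [x]"
    then obtain s where "0 \<le> s" "s \<le> 1" "z = (s * frac r) *\<^sub>R v"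
      by (auto simp: x_def mem_closed_segment_0)
    moreover from this have "0 \<le> s * frac r" "s * frac r \<le> 1"
      using r by (auto intro: mult_le_one mult_nonneg_nonneg)
    ultimately show "z \<in> zonotope [v]"
      unfolding zonotope_Cons zonotope_Nil set_add_0_right mem_closed_segment_0 by blast
  qed
  moreover have "linear (\<lambda>y. y \<bullet> v)"
    by (intro bounded_linear.linear bounded_linear_inner_left)
  ultimately have "width (\<lambda>y. y \<bullet> v) [x] = width (\<lambda>y. y \<bullet> v) [v]"
    using x v r by (intro tight_exchange[where t = 0]) (auto simp: x_def)
  then show False
    using v r by (simp add: x_def abs_mult)
qed

subsection \<open>Lattice bases of \<open>\<int>\<^sup>3\<close>\<close>

lemma cross3_mem_integer_lattice [simp]:
  "a \<in> integer_lattice \<Longrightarrow> b \<in> integer_lattice \<Longrightarrow> cross3 a b \<in> integer_lattice"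
  by (auto simp: integer_lattice_def forall_3 cross_components)

lemma inner_mem_Ints: "a \<in> integer_lattice \<Longrightarrow> b \<in> integer_lattice \<Longrightarrow> a \<bullet> b \<in> \<int>"
  by (auto simp: integer_lattice_def inner_vec_def intro!: Ints_sum)

text \<open>The determinant of \<open>a, b, c\<close>.\<close>

definition triple :: "real ^ 3 \<Rightarrow> real ^ 3 \<Rightarrow> real ^ 3 \<Rightarrow> real" where
  "triple a b c = a \<bullet> cross3 b c"

lemma triple_linear [simp]:
  "triple (a + a') b c = triple a b c + triple a' b c"
  "triple a (b + b') c = triple a b c + triple a b' c"
  "triple a b (c + c') = triple a b c + triple a b c'"
  "triple (a - a') b c = triple a b c - triple a' b c"
  "triple a (b - b') c = triple a b c - triple a b' c"
  "triple a b (c - c') = triple a b c - triple a b c'"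
  "triple (- a) b c = - triple a b c"
  "triple a (- b) c = - triple a b c"
  "triple a b (- c) = - triple a b c"
  "triple (r *\<^sub>R a) b c = r * triple a b c"
  "triple a (r *\<^sub>R b) c = r * triple a b c"
  "triple a b (r *\<^sub>R c) = r * triple a b c"
  by (simp_all add: triple_def inner_vec_def sum_3 cross_components algebra_simps)

lemma triple_alternating [simp]: "triple a a b = 0" "triple a b a = 0" "triple a b b = 0"
  by (simp_all add: triple_def dot_cross_self)

lemma triple_swap: "triple b a c = - triple a b c" "triple a c b = - triple a b c"
  by (simp_all add: triple_def inner_vec_def sum_3 cross_components algebra_simps)

lemma triple_cramer:
  "triple a b c *\<^sub>R x = triple x b c *\<^sub>R a + triple a x c *\<^sub>R b + triple a b x *\<^sub>R c"
  by (simp add: triple_def inner_vec_def sum_3 cross_components vec_eq_iff forall_3 algebra_simps)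

lemma triple_coordinates:
  assumes "triple a b c \<noteq> 0"
  shows "\<exists>p q r. x = p *\<^sub>R a + q *\<^sub>R b + r *\<^sub>R c"
proof -
  have "x = (1 / triple a b c) *\<^sub>R (triple a b c *\<^sub>R x)"
    using assms by simp
  also have "\<dots> = (triple x b c / triple a b c) *\<^sub>R a + (triple a x c / triple a b c) *\<^sub>R b
      + (triple a b x / triple a b c) *\<^sub>R c"
    unfolding triple_cramer[of a b c x] by (simp add: scaleR_add_right)
  finally show ?thesis by blast
qed

text \<open>Supplies the test functionals for widths: values on three independent vectors can be
  prescribed, with coordinates read off by Cramer's rule.\<close>

lemma triple_dual:
  assumes "triple a b c \<noteq> 0"
  shows "\<exists>f. linear f \<and> (\<forall>r s t. f (r *\<^sub>R a + s *\<^sub>R b + t *\<^sub>R c) = r * p + s * q + t * (u :: real))"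
proof -
  define f where "f x = (triple x b c * p + triple a x c * q + triple a b x * u) / triple a b c" for x
  have "linear f"
    by (rule linearI) (simp_all add: f_def algebra_simps add_divide_distrib)
  moreover have "f (r *\<^sub>R a + s *\<^sub>R b + t *\<^sub>R c) = r * p + s * q + t * u" for r s t
    using assms by (simp add: f_def field_simps)
  ultimately show ?thesis by blast
qed

lemma triple_coordinates_eq:
  assumes "triple a b c \<noteq> 0"
    "p *\<^sub>R a + q *\<^sub>R b + r *\<^sub>R c = p' *\<^sub>R a + q' *\<^sub>R b + r' *\<^sub>R c"
  shows "p = p' \<and> q = q' \<and> r = r'"
  using arg_cong[OF assms(2), of "\<lambda>x. triple x b c"] arg_cong[OF assms(2), of "\<lambda>x. triple a x c"]
    arg_cong[OF assms(2), of "\<lambda>x. triple a b x"] assms(1) by simp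

lemma triple_cross: "triple a b (cross3 a b) \<noteq> 0 \<longleftrightarrow> cross3 a b \<noteq> 0"
proof -
  have "triple a b (cross3 a b) = cross3 a b \<bullet> cross3 a b"
    by (simp add: triple_def inner_vec_def sum_3 cross_components algebra_simps)
  then show ?thesis by simp
qed

text \<open>A basis of the group of integer points. Generation is expressed by integrality of real
  coordinates, which suits arguments that exhibit a lattice point with a fractional
  coordinate.\<close>

definition lattice_basis :: "real ^ 3 \<Rightarrow> real ^ 3 \<Rightarrow> real ^ 3 \<Rightarrow> bool" where
  "lattice_basis a b c \<longleftrightarrow> {a, b, c} \<subseteq> integer_lattice \<and> triple a b c \<noteq> 0 \<and>
     (\<forall>p q r. p *\<^sub>R a + q *\<^sub>R b + r *\<^sub>R c \<in> integer_lattice \<longrightarrow> p \<in> \<int> \<and> q \<in> \<int> \<and> r \<in> \<int>)"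

lemma lattice_basisI:
  assumes "a \<in> integer_lattice" "b \<in> integer_lattice" "c \<in> integer_lattice" "triple a b c \<noteq> 0"
    "\<And>p q r. p *\<^sub>R a + q *\<^sub>R b + r *\<^sub>R c \<in> integer_lattice \<Longrightarrow> p \<in> \<int> \<and> q \<in> \<int> \<and> r \<in> \<int>"
  shows "lattice_basis a b c"
  unfolding lattice_basis_def using assms by blast

lemma lattice_basisD:
  assumes "lattice_basis a b c"
  shows "a \<in> integer_lattice" "b \<in> integer_lattice" "c \<in> integer_lattice" "triple a b c \<noteq> 0"
  using assms by (auto simp only: lattice_basis_def)

lemma lattice_basis_coordinates:
  "lattice_basis a b c \<Longrightarrow> p *\<^sub>R a + q *\<^sub>R b + r *\<^sub>R c \<in> integer_lattice \<Longrightarrow> p \<in> \<int> \<and> q \<in> \<int> \<and> r \<in> \<int>"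
  unfolding lattice_basis_def by blast

section \<open>Completion to lattice bases\<close>

text \<open>Division with remainder: \<open>f\<close> maps \<open>G\<close> into the integers, and
  an element of least positive value generates the image. The closure condition on \<open>G\<close>
  is exactly what forming remainders needs.\<close>

lemma minimal_positive_functional_value:
  fixes f :: "real ^ 'n \<Rightarrow> real"
  assumes "linear f" "\<And>x. x \<in> G \<Longrightarrow> f x \<in> \<int>"
    and G: "\<And>x y k. x \<in> G \<Longrightarrow> y \<in> G \<Longrightarrow> k \<in> \<int> \<Longrightarrow> x - k *\<^sub>R y \<in> G"
    and "z \<in> G" "f z > 0"
  shows "\<exists>c \<in> G. f c > 0 \<and> (\<forall>x \<in> G. \<exists>k \<in> \<int>. f x = k * f c)"
proof -
  define c where "c = arg_min (\<lambda>x. nat \<lfloor>f x\<rfloor>) (\<lambda>x. x \<in> G \<and> f x > 0)"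
  have c: "c \<in> G" "f c > 0" and min: "\<And>x. x \<in> G \<Longrightarrow> f x > 0 \<Longrightarrow> nat \<lfloor>f c\<rfloor> \<le> nat \<lfloor>f x\<rfloor>"
    using arg_min_nat_lemma[of "\<lambda>x. x \<in> G \<and> f x > 0" z "\<lambda>x. nat \<lfloor>f x\<rfloor>"] assms(4,5)
    unfolding c_def by auto
  have "f x = of_int \<lfloor>f x / f c\<rfloor> * f c" if "x \<in> G" for x
  proof -
    \<comment> \<open>The remainder: its value lies in \<open>[0, f c)\<close>, so by minimality of
      \<open>c\<close> it is zero.\<close>
    define y where "y = x - of_int \<lfloor>f x / f c\<rfloor> *\<^sub>R c"
    have y: "y \<in> G"
      unfolding y_def using that c by (intro G) auto
    have fy: "f y = f x - of_int \<lfloor>f x / f c\<rfloor> * f c"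
      using assms(1) by (simp add: y_def linear_diff linear_scale)
    then have "f y = frac (f x / f c) * f c"
      using c by (simp add: frac_def left_diff_distrib)
    then have "0 \<le> f y" "f y < f c"
      using c frac_lt_1[of "f x / f c"] frac_ge_0[of "f x / f c"] by (simp_all add: mult_less_cancel_right1)
    moreover have "f y \<in> \<int>" "f c \<in> \<int>"
      using y c assms(2) by auto
    ultimately have "f y = 0"
      using min[OF y] by (cases "f y > 0") (auto elim!: Ints_cases)
    then show ?thesis
      using fy by simp
  qed
  then show ?thesis
    using c by (metis Ints_of_int)
qed

text \<open>Take \<open>c\<close> of least positive height over the plane of \<open>a, b\<close>.
  Heights of lattice points are then integer multiples of that of \<open>c\<close>, and subtracting
  the multiple of \<open>c\<close> reduces to the plane.\<close>

lemma lattice_basis_completion: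
  assumes "a \<in> integer_lattice" "b \<in> integer_lattice" "cross3 a b \<noteq> 0"
    and ab: "\<And>p q. p *\<^sub>R a + q *\<^sub>R b \<in> integer_lattice \<Longrightarrow> p \<in> \<int> \<and> q \<in> \<int>"
  shows "\<exists>c. lattice_basis a b c"
proof -
  define f where "f x = x \<bullet> cross3 a b" for x
  have "linear f"
    unfolding f_def[abs_def] by (intro bounded_linear.linear bounded_linear_inner_left)
  moreover have "f x \<in> \<int>" if "x \<in> integer_lattice" for x
    using that assms(1,2) by (simp add: f_def inner_mem_Ints)
  moreover have "f (cross3 a b) > 0"
    using assms(3) by (simp add: f_def)
  ultimately obtain c where c: "c \<in> integer_lattice" "f c > 0"
    "\<And>x. x \<in> integer_lattice \<Longrightarrow> \<exists>k \<in> \<int>. f x = k * f c"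
    using minimal_positive_functional_value[of f integer_lattice "cross3 a b"] assms(1,2) by auto
  have f: "f (p *\<^sub>R a + q *\<^sub>R b + r *\<^sub>R c) = r * f c" for p q r
    by (simp add: f_def inner_add_left dot_cross_self)
  have "triple a b c = f c"
    by (simp add: f_def triple_def inner_vec_def sum_3 cross_components algebra_simps)
  then have nz: "triple a b c \<noteq> 0"
    using c(2) by simp
  have ints: "p \<in> \<int> \<and> q \<in> \<int> \<and> r \<in> \<int>" if x: "p *\<^sub>R a + q *\<^sub>R b + r *\<^sub>R c \<in> integer_lattice" for p q r
  proof -
    have r: "r \<in> \<int>"
      using c(2) c(3)[OF x] unfolding f by auto
    then have "p *\<^sub>R a + q *\<^sub>R b + r *\<^sub>R c - r *\<^sub>R c \<in> integer_lattice"
      using x c by (intro integer_lattice_diff) auto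
    then have "p *\<^sub>R a + q *\<^sub>R b \<in> integer_lattice"
      by simp
    then show ?thesis
      using ab r by blast
  qed
  have "lattice_basis a b c"
    by (rule lattice_basisI[OF assms(1,2) c(1) nz ints])
  then show ?thesis ..
qed

text \<open>The vector \<open>cross3 a e1\<close> works unless \<open>a\<close> is parallel to
  \<open>e1\<close>, in which case \<open>e2\<close> does.\<close>

lemma exists_orthogonal_lattice_vector:
  "\<exists>y \<in> integer_lattice. y \<noteq> 0 \<and> y \<bullet> a = 0" if "a \<in> integer_lattice" for a :: "real ^ 3"
proof (cases "cross3 a e1 = 0")
  case True
  then have "e2 \<bullet> a = 0"
    by (simp add: cross3_simps axis_def forall_3 inner_axis')
  then show ?thesis
    by (intro bexI[of _ e2]) auto
next
  case False
  then show ?thesis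
    using that by (intro bexI[of _ "cross3 a e1"]) (auto simp: dot_cross_self inner_commute)
qed

text \<open>The same height argument one dimension lower: in the plane orthogonal to a lattice
  vector \<open>y\<close>, which contains \<open>a\<close>, choose \<open>b\<close> of least
  positive height over the line of \<open>a\<close>, then complete the pair.\<close>

lemma lattice_basis_completion_primitive:
  assumes "a \<in> integer_lattice" "a \<noteq> 0" and a: "\<And>p. p *\<^sub>R a \<in> integer_lattice \<Longrightarrow> p \<in> \<int>"
  shows "\<exists>b c. lattice_basis a b c"
proof -
  obtain y where y: "y \<in> integer_lattice" "y \<noteq> 0" "y \<bullet> a = 0"
    using exists_orthogonal_lattice_vector assms(1) by blast
  define G where "G = {x \<in> integer_lattice. y \<bullet> x = 0}"
  define f where "f x = x \<bullet> cross3 a y" for x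
  have "a \<bullet> a \<noteq> 0" "y \<bullet> y \<noteq> 0"
    using assms(2) y by auto
  moreover have "cross3 a y \<bullet> cross3 a y = (a \<bullet> a) * (y \<bullet> y) - (y \<bullet> a)\<^sup>2"
    by (simp add: inner_vec_def sum_3 cross_components power2_eq_square algebra_simps)
  ultimately have "cross3 a y \<noteq> 0"
    using y by auto
  then have z: "f (cross3 a y) > 0" "cross3 a y \<in> G"
    using assms(1) y by (auto simp: f_def G_def dot_cross_self)
  have lin: "linear f"
    unfolding f_def[abs_def] by (intro bounded_linear.linear bounded_linear_inner_left)
  moreover have "f x \<in> \<int>" if "x \<in> G" for x
    using that assms(1) y by (simp add: f_def G_def inner_mem_Ints)
  moreover have "x - k *\<^sub>R x' \<in> G" if "x \<in> G" "x' \<in> G" "k \<in> \<int>" for x x' k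
    using that by (simp add: G_def inner_diff_right)
  ultimately obtain b where b: "b \<in> G" "f b > 0" "\<And>x. x \<in> G \<Longrightarrow> \<exists>k \<in> \<int>. f x = k * f b"
    using minimal_positive_functional_value[of f G "cross3 a y"] z by auto
  have fa: "f a = 0"
    by (simp add: f_def dot_cross_self)
  have "f b = - (y \<bullet> cross3 a b)"
    by (simp add: f_def inner_vec_def sum_3 cross_components algebra_simps)
  then have "cross3 a b \<noteq> 0"
    using b by auto
  moreover have "p \<in> \<int> \<and> q \<in> \<int>" if x: "p *\<^sub>R a + q *\<^sub>R b \<in> integer_lattice" for p q
  proof -
    have "p *\<^sub>R a + q *\<^sub>R b \<in> G"
      using x b y by (simp add: G_def inner_add_right)
    from b(3)[OF this] have q: "q \<in> \<int>"
      using b(2) lin fa by (auto simp: linear_add linear_scale)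
    then have "p *\<^sub>R a + q *\<^sub>R b - q *\<^sub>R b \<in> integer_lattice"
      using x b by (intro integer_lattice_diff) (auto simp: G_def)
    then show ?thesis
      using a q by simp
  qed
  ultimately show ?thesis
    using lattice_basis_completion[of a b] assms(1) b(1) unfolding G_def by blast
qed

section \<open>Lattice points in parallelograms and parallelepipeds of a tight list\<close>

lemma tight_pair:
  fixes vs :: "(real ^ 3) list"
  assumes "tight vs" "a \<in> directions vs" "b \<in> directions vs" "cross3 a b \<noteq> 0"
    "p *\<^sub>R a + q *\<^sub>R b \<in> integer_lattice"
  shows "p \<in> \<int> \<and> q \<in> \<int>"
proof (rule ccontr)
  assume contr: "\<not> (p \<in> \<int> \<and> q \<in> \<int>)"
  \<comment> \<open>Reduction modulo \<open>a\<close> and \<open>b\<close> moves the offending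
    lattice point into the half-open parallelogram, away from the origin.\<close>
  define r s where "r = frac p" and "s = frac q"
  have rs: "0 \<le> r" "r < 1" "0 \<le> s" "s < 1" "r \<noteq> 0 \<or> s \<noteq> 0"
    using contr by (auto simp: r_def s_def frac_lt_1)
  have ab: "a \<in> integer_lattice" "b \<in> integer_lattice"
    using assms tight_directions by auto
  \<comment> \<open>Any vector outside the plane serves, for instance \<open>cross3 a b\<close>; it
    only makes coordinates and functionals available.\<close>
  obtain c where c: "triple a b c \<noteq> 0"
    using assms(4) triple_cross by blast
  define x where "x = r *\<^sub>R a + s *\<^sub>R b"
  have "x = p *\<^sub>R a + q *\<^sub>R b - (of_int \<lfloor>p\<rfloor> *\<^sub>R a + of_int \<lfloor>q\<rfloor> *\<^sub>R b)"
    by (simp add: x_def r_def s_def frac_def algebra_simps)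
  then have x: "x \<in> integer_lattice"
    using assms(5) ab by simp
  define x' where "x' = (1 - r) *\<^sub>R a + (1 - s) *\<^sub>R b"
  have x': "x' = a + b - x"
    by (simp add: x_def x'_def algebra_simps)
  have nz: "x \<noteq> 0" "x' \<noteq> 0"
  proof -
    show "x \<noteq> 0"
      using triple_coordinates_eq[OF c, of r s 0 0 0 0] rs by (auto simp: x_def)
    show "x' \<noteq> 0"
      using triple_coordinates_eq[OF c, of "1 - r" "1 - s" 0 0 0 0] rs by (auto simp: x'_def)
  qed
  have "a \<noteq> b" "a \<noteq> - b"
    using assms(4) by auto
  then obtain rest where "tight ([a, b] @ rest)"
    using tight_extract[OF assms(1), of "[a, b]"] assms(2,3) by auto
  moreover have "{0} + zonotope [x, x'] \<subseteq> zonotope [a, b]"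
  proof
    fix w assume "w \<in> {0} + zonotope [x, x']"
    then obtain i j where ij: "0 \<le> i" "i \<le> 1" "0 \<le> j" "j \<le> 1" "w - i *\<^sub>R x - j *\<^sub>R x' = 0"
      by (auto simp: mem_zonotope_Cons simp del: zonotope_Cons)
    define m n where "m = i * r + j * (1 - r)" and "n = i * s + j * (1 - s)"
    have conv: "0 \<le> i * u + j * (1 - u) \<and> i * u + j * (1 - u) \<le> 1" if "0 \<le> u" "u < 1" for u
      using that ij convex_bound_le[of i 1 j u "1 - u"] by (auto simp: mult.commute)
    have "w = i *\<^sub>R x + j *\<^sub>R x'"
      using ij(5) by (simp add: algebra_simps)
    then have "w - m *\<^sub>R a - n *\<^sub>R b = 0"
      by (simp add: x_def x'_def m_def n_def algebra_simps)
    then show "w \<in> zonotope [a, b]"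
      using conv[of r] conv[of s] rs unfolding mem_zonotope_Cons zonotope_Nil m_def n_def by blast
  qed
  \<comment> \<open>With values \<open>1\<close> on \<open>a\<close> and \<open>-1\<close> on
    \<open>b\<close>, the width of \<open>[a, b]\<close> is 2, but that of \<open>[x, x']\<close> is
    \<open>2 * \<bar>r - s\<bar>\<close>, which is less than 2.\<close>
  moreover obtain f where f: "linear f" "\<And>i j k. f (i *\<^sub>R a + j *\<^sub>R b + k *\<^sub>R c) = i * 1 + j * (- 1) + k * 0"
    using triple_dual[OF c] by blast
  ultimately have "width f [x, x'] = width f [a, b]"
    using x ab nz x' by (intro tight_exchange[where t = 0]) auto
  moreover have "f a = 1" "f b = - 1" "f x = r - s" "f x' = s - r"
    using f(2)[of 1 0 0] f(2)[of 0 1 0] f(2)[of r s 0] f(2)[of "1 - r" "1 - s" 0]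
    by (simp_all add: x_def x'_def)
  ultimately show False
    using rs by auto
qed

text \<open>In one coordinate of the box: a path from the corner \<open>e\<close> through \<open>p\<close> and \<open>q\<close> to the
  opposite corner \<open>1 - e\<close> is monotone, so its steps span a box inside \<open>[0, 1]\<close>.\<close>

lemma corner_path:
  fixes p q :: real
  assumes "0 \<le> p" "p \<le> 1" "0 \<le> q" "q \<le> 1" and e: "e = (if p \<le> q then 0 else 1)"
  shows "\<bar>p - e\<bar> + \<bar>q - p\<bar> + \<bar>1 - e - q\<bar> = 1"
    and "0 \<le> i \<Longrightarrow> i \<le> 1 \<Longrightarrow> 0 \<le> j \<Longrightarrow> j \<le> 1 \<Longrightarrow> 0 \<le> k \<Longrightarrow> k \<le> 1 \<Longrightarrow>
      0 \<le> e + i * (p - e) + j * (q - p) + k * (1 - e - q) \<and>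
      e + i * (p - e) + j * (q - p) + k * (1 - e - q) \<le> 1"
proof -
  show "\<bar>p - e\<bar> + \<bar>q - p\<bar> + \<bar>1 - e - q\<bar> = 1"
    using assms by auto
  assume ijk: "0 \<le> i" "i \<le> 1" "0 \<le> j" "j \<le> 1" "0 \<le> k" "k \<le> 1"
  have *: "0 \<le> t * u \<and> t * u \<le> u" if "0 \<le> t" "t \<le> 1" "0 \<le> u" for t u :: real
    using that by (simp add: mult_left_le_one_le)
  show "0 \<le> e + i * (p - e) + j * (q - p) + k * (1 - e - q) \<and>
      e + i * (p - e) + j * (q - p) + k * (1 - e - q) \<le> 1"
  proof (cases "p \<le> q")
    case True
    then show ?thesis
      using *[of i p] *[of j "q - p"] *[of k "1 - q"] ijk assms by simp
  next
    case False
    then have "e + i * (p - e) + j * (q - p) + k * (1 - e - q) =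
        1 - i * (1 - p) - j * (p - q) - k * q"
      using e by (simp add: algebra_simps)
    then show ?thesis
      using *[of i "1 - p"] *[of j "p - q"] *[of k q] ijk assms(1-4) False by argo
  qed
qed

text \<open>Since \<open>\<bar>t + m\<bar> + \<bar>m - t\<bar>\<close> is twice the maximum of
  \<open>\<bar>t\<bar>\<close> and \<open>m\<close>, it is at most
  \<open>2 * (\<bar>t\<bar> + m)\<close>, with equality for \<open>m > 0\<close> only if
  \<open>t = 0\<close>. The hypotheses force equality in all three terms, so every \<open>t\<close>
  vanishes, against their absolute sum being 1.\<close>

lemma abs_sum_rigid:
  fixes m1 m2 m3 t1 t2 t3 :: real
  assumes m: "0 < m1" "0 < m2" "0 < m3" "m1 + m2 + m3 = 1"
    and t: "\<bar>t1\<bar> + \<bar>t2\<bar> + \<bar>t3\<bar> = 1"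
    and plus: "\<bar>t1 + m1\<bar> + \<bar>t2 + m2\<bar> + \<bar>t3 + m3\<bar> = 2"
    and minus: "\<bar>m1 - t1\<bar> + \<bar>m2 - t2\<bar> + \<bar>m3 - t3\<bar> = 2"
  shows False
proof -
  \<comment> \<open>The defect in this estimate, equal to twice the minimum of
    \<open>\<bar>t\<bar>\<close> and \<open>m\<close> when \<open>m > 0\<close>.\<close>
  define w where "w t m = 2 * (\<bar>t\<bar> + m) - \<bar>t + m\<bar> - \<bar>m - t\<bar>" for t m :: real
  have w: "0 \<le> w t m" "w t m = 0 \<Longrightarrow> t = 0" if "0 < m" for t m
    using that by (auto simp: w_def abs_if split: if_splits)
  have "w t1 m1 + w t2 m2 + w t3 m3 =
      2 * (\<bar>t1\<bar> + \<bar>t2\<bar> + \<bar>t3\<bar>) + 2 * (m1 + m2 + m3)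
      - (\<bar>t1 + m1\<bar> + \<bar>t2 + m2\<bar> + \<bar>t3 + m3\<bar>) - (\<bar>m1 - t1\<bar> + \<bar>m2 - t2\<bar> + \<bar>m3 - t3\<bar>)"
    by (simp add: w_def algebra_simps)
  then have "w t1 m1 + w t2 m2 + w t3 m3 = 0"
    unfolding m(4) t plus minus by simp
  then have "w t1 m1 = 0 \<and> w t2 m2 = 0 \<and> w t3 m3 = 0"
    using w(1)[OF m(1), of t1] w(1)[OF m(2), of t2] w(1)[OF m(3), of t3] by linarith
  then have "t1 = 0 \<and> t2 = 0 \<and> t3 = 0"
    using w(2)[OF m(1)] w(2)[OF m(2)] w(2)[OF m(3)] by blast
  then show False
    using t by simp
qed

lemma lattice_basis_uminus:
  assumes "lattice_basis a b c"
  shows "lattice_basis a b (- c)"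
proof -
  have ints: "p \<in> \<int> \<and> q \<in> \<int> \<and> r \<in> \<int>" if "p *\<^sub>R a + q *\<^sub>R b + r *\<^sub>R (- c) \<in> integer_lattice" for p q r
  proof -
    have "p *\<^sub>R a + q *\<^sub>R b + (- r) *\<^sub>R c \<in> integer_lattice"
      using that by simp
    then have "p \<in> \<int> \<and> q \<in> \<int> \<and> - r \<in> \<int>"
      by (rule lattice_basis_coordinates[OF assms])
    then show ?thesis
      by (simp add: minus_in_Ints_iff)
  qed
  show ?thesis
    using lattice_basisD[OF assms] by (intro lattice_basisI[OF _ _ _ _ ints]) simp_all
qed

text \<open>The steps \<open>u, v, w\<close> of the path from a corner \<open>s\<close> through the
  two points to the opposite corner span a zonotope inside the parallelepiped. Comparing widths for
  two functionals contradicts \<open>abs_sum_rigid\<close>, where \<open>m\<close> are the steps in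
  the \<open>c\<close> coordinate and \<open>t\<close> those in the \<open>a\<close>
  coordinate.\<close>

lemma tight_triple_no_two_points:
  fixes vs :: "(real ^ 3) list"
  assumes "tight vs" "a \<in> directions vs" "b \<in> directions vs" "c \<in> directions vs"
    and abc: "triple a b c \<noteq> 0"
    and p: "0 \<le> p1" "p1 \<le> 1" "0 \<le> p2" "p2 \<le> 1"
    and q: "0 \<le> q1" "q1 \<le> 1" "0 \<le> q2" "q2 \<le> 1"
    and 3: "0 < p3" "p3 < q3" "q3 < 1"
    and x: "p1 *\<^sub>R a + p2 *\<^sub>R b + p3 *\<^sub>R c \<in> integer_lattice"
    and y: "q1 *\<^sub>R a + q2 *\<^sub>R b + q3 *\<^sub>R c \<in> integer_lattice"
  shows False
proof -
  have ab: "a \<in> integer_lattice" "b \<in> integer_lattice" "c \<in> integer_lattice"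
    using assms tight_directions by auto
  \<comment> \<open>The starting corner makes the path monotone in the first two coordinates; in the
    third it starts at 0, because \<open>p3 < q3\<close>.\<close>
  define d e :: real where "d = (if p1 \<le> q1 then 0 else 1)" and "e = (if p2 \<le> q2 then 0 else 1)"
  have de: "d \<in> \<int>" "e \<in> \<int>"
    by (auto simp: d_def e_def)
  define s where "s = d *\<^sub>R a + e *\<^sub>R b"
  define u where "u = (p1 - d) *\<^sub>R a + (p2 - e) *\<^sub>R b + p3 *\<^sub>R c"
  define v where "v = (q1 - p1) *\<^sub>R a + (q2 - p2) *\<^sub>R b + (q3 - p3) *\<^sub>R c"
  define w where "w = (1 - d - q1) *\<^sub>R a + (1 - e - q2) *\<^sub>R b + (1 - q3) *\<^sub>R c"
  have "u = (p1 *\<^sub>R a + p2 *\<^sub>R b + p3 *\<^sub>R c) - s"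
    by (simp add: u_def s_def algebra_simps)
  then have u: "u \<in> integer_lattice"
    using x ab de by (simp add: s_def)
  have "v = (q1 *\<^sub>R a + q2 *\<^sub>R b + q3 *\<^sub>R c) - (p1 *\<^sub>R a + p2 *\<^sub>R b + p3 *\<^sub>R c)"
    by (simp add: v_def algebra_simps)
  then have v: "v \<in> integer_lattice"
    using integer_lattice_diff[OF y x] by simp
  have "w = (a + b + c - s) - (q1 *\<^sub>R a + q2 *\<^sub>R b + q3 *\<^sub>R c)"
    by (simp add: w_def s_def algebra_simps)
  moreover have s: "s \<in> integer_lattice"
    using ab de by (simp add: s_def)
  ultimately have w: "w \<in> integer_lattice"
    using y ab by (auto intro!: integer_lattice_diff)
  have nz: "u \<noteq> 0" "v \<noteq> 0" "w \<noteq> 0"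
    using triple_coordinates_eq[OF abc, of "p1 - d" "p2 - e" p3 0 0 0]
      triple_coordinates_eq[OF abc, of "q1 - p1" "q2 - p2" "q3 - p3" 0 0 0]
      triple_coordinates_eq[OF abc, of "1 - d - q1" "1 - e - q2" "1 - q3" 0 0 0] 3
    by (auto simp: u_def v_def w_def)
  have "a \<noteq> b" "a \<noteq> - b" "a \<noteq> c" "a \<noteq> - c" "b \<noteq> c" "b \<noteq> - c"
    using abc by auto
  then obtain rest where rest: "tight ([a, b, c] @ rest)"
    using tight_extract[OF assms(1), of "[a, b, c]"] assms(2-4) by auto
  have sub: "{s} + zonotope [u, v, w] \<subseteq> zonotope [a, b, c]"
  proof
    fix z assume "z \<in> {s} + zonotope [u, v, w]"
    then obtain i j k where ijk: "0 \<le> i" "i \<le> 1" "0 \<le> j" "j \<le> 1" "0 \<le> k" "k \<le> 1"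
      "z - s - i *\<^sub>R u - j *\<^sub>R v - k *\<^sub>R w = 0"
      unfolding mem_singleton_plus mem_zonotope_Cons zonotope_Nil by auto
    \<comment> \<open>The coordinates of \<open>z\<close>. The zeros in \<open>z3\<close> are kept
      so that \<open>corner_path\<close> applies with \<open>e = 0\<close>.\<close>
    define z1 z2 z3 where "z1 = d + i * (p1 - d) + j * (q1 - p1) + k * (1 - d - q1)"
      and "z2 = e + i * (p2 - e) + j * (q2 - p2) + k * (1 - e - q2)"
      and "z3 = 0 + i * (p3 - 0) + j * (q3 - p3) + k * (1 - 0 - q3)"
    have "0 \<le> z1 \<and> z1 \<le> 1" "0 \<le> z2 \<and> z2 \<le> 1" "0 \<le> z3 \<and> z3 \<le> 1"
      unfolding z1_def z2_def z3_def using p q 3 ijk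
      by (intro corner_path(2); simp add: d_def e_def)+
    moreover have "z = s + i *\<^sub>R u + j *\<^sub>R v + k *\<^sub>R w"
      using ijk(7) by (simp add: algebra_simps)
    then have "z - z1 *\<^sub>R a - z2 *\<^sub>R b - z3 *\<^sub>R c = 0"
      by (simp add: s_def u_def v_def w_def z1_def z2_def z3_def algebra_simps)
    ultimately show "z \<in> zonotope [a, b, c]"
      unfolding mem_zonotope_Cons zonotope_Nil by blast
  qed
  \<comment> \<open>The functional with values \<open>g, 0, 1\<close> on \<open>a, b, c\<close>;
    only \<open>g = 1\<close> and \<open>g = - 1\<close> are needed.\<close>
  have width: "\<bar>g * (p1 - d) + p3\<bar> + \<bar>g * (q1 - p1) + (q3 - p3)\<bar> + \<bar>g * (1 - d - q1) + (1 - q3)\<bar> = \<bar>g\<bar> + 1" for g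
  proof -
    obtain f where f: "linear f" "\<And>i j k. f (i *\<^sub>R a + j *\<^sub>R b + k *\<^sub>R c) = i * g + j * 0 + k * 1"
      using triple_dual[OF abc] by blast
    have "width f [u, v, w] = width f [a, b, c]"
      using tight_exchange[OF rest _ _ s sub f(1)] u v w nz by simp
    moreover have "f a = g" "f b = 0" "f c = 1"
      using f(2)[of 1 0 0] f(2)[of 0 1 0] f(2)[of 0 0 1] by simp_all
    ultimately show ?thesis
      by (simp add: u_def v_def w_def f(2) mult.commute)
  qed
  have one: "\<bar>p1 - d\<bar> + \<bar>q1 - p1\<bar> + \<bar>1 - d - q1\<bar> = 1"
    using p q by (intro corner_path(1)) (auto simp: d_def)
  have plus: "\<bar>p1 - d + p3\<bar> + \<bar>q1 - p1 + (q3 - p3)\<bar> + \<bar>1 - d - q1 + (1 - q3)\<bar> = 2"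
    using width[of 1] unfolding mult_1 by simp
  have "- 1 * t + m = m - t" for t m :: real
    by simp
  then have "\<bar>p3 - (p1 - d)\<bar> + \<bar>q3 - p3 - (q1 - p1)\<bar> + \<bar>1 - q3 - (1 - d - q1)\<bar> = \<bar>- 1\<bar> + 1"
    using width[of "- 1"] by (simp only:)
  then have minus: "\<bar>p3 - (p1 - d)\<bar> + \<bar>q3 - p3 - (q1 - p1)\<bar> + \<bar>1 - q3 - (1 - d - q1)\<bar> = 2"
    by (simp only: abs_neg_one one_add_one)
  show False
    by (rule abs_sum_rigid[OF _ _ _ _ one plus minus]) (use 3 in simp_all)
qed

text \<open>Completing \<open>a, b\<close> to a lattice basis by \<open>f\<close> and writing \<open>c = p a + q b + r f\<close> with
  \<open>r > 0\<close>, the layers of the parallelepiped through \<open>f\<close> and \<open>2 f\<close> each contain a lattice point,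
  so \<open>r > 2\<close> is impossible.\<close>

lemma tight_triple:
  fixes vs :: "(real ^ 3) list"
  assumes "tight vs" "a \<in> directions vs" "b \<in> directions vs" "c \<in> directions vs"
    and abc: "triple a b c \<noteq> 0"
  shows "lattice_basis a b c \<or> lattice_basis a b ((1/2) *\<^sub>R (a + b + c))"
proof -
  have ab: "a \<in> integer_lattice" "b \<in> integer_lattice" "c \<in> integer_lattice"
    using assms tight_directions by auto
  have crs: "cross3 a b \<noteq> 0" "cross3 a c \<noteq> 0" "cross3 b c \<noteq> 0"
  proof -
    show "cross3 b c \<noteq> 0" using abc by (auto simp: triple_def)
    have "triple a b c = - (b \<bullet> cross3 a c)" "triple a b c = c \<bullet> cross3 a b"
      by (simp_all add: triple_def inner_vec_def sum_3 cross_components algebra_simps)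
    then show "cross3 a b \<noteq> 0" "cross3 a c \<noteq> 0"
      using abc by auto
  qed
  note pair = tight_pair[OF assms(1)]
  obtain f0 where f0: "lattice_basis a b f0"
    using lattice_basis_completion[OF ab(1,2) crs(1) pair[OF assms(2,3) crs(1)]] by blast
  obtain p q r0 where c0: "c = p *\<^sub>R a + q *\<^sub>R b + r0 *\<^sub>R f0"
    using triple_coordinates lattice_basisD(4)[OF f0] by blast
  have int: "p \<in> \<int>" "q \<in> \<int>" "r0 \<in> \<int>"
    using lattice_basis_coordinates[OF f0] ab(3) unfolding c0 by blast+
  \<comment> \<open>Replacing \<open>f0\<close> by its negative if necessary makes the height of
    \<open>c\<close> positive.\<close>
  define r f where "r = \<bar>r0\<bar>" and "f = (if r0 \<ge> 0 then f0 else - f0)"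
  have c: "c = p *\<^sub>R a + q *\<^sub>R b + r *\<^sub>R f"
    using c0 by (simp add: r_def f_def)
  have "r0 \<noteq> 0"
    using abc c0 by auto
  then have r: "r > 0" "r \<in> \<int>"
    using int by (auto simp: r_def)
  have f: "lattice_basis a b f"
    using f0 lattice_basis_uminus[OF f0] by (simp add: f_def)
  have fl: "f \<in> integer_lattice"
    using f by (rule lattice_basisD)
  have fc: "f = (1 / r) *\<^sub>R c - (p / r) *\<^sub>R a - (q / r) *\<^sub>R b"
    using r unfolding c by (simp add: algebra_simps)
  have layer: "\<exists>i j. 0 \<le> i \<and> i \<le> 1 \<and> 0 \<le> j \<and> j \<le> 1 \<and>
      i *\<^sub>R a + j *\<^sub>R b + (k / r) *\<^sub>R c \<in> integer_lattice" if "k \<in> \<int>" for k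
  proof -
    have "frac (- (k * p / r)) *\<^sub>R a + frac (- (k * q / r)) *\<^sub>R b + (k / r) *\<^sub>R c =
       k *\<^sub>R f - of_int \<lfloor>- (k * p / r)\<rfloor> *\<^sub>R a - of_int \<lfloor>- (k * q / r)\<rfloor> *\<^sub>R b"
      by (simp add: fc frac_def algebra_simps)
    also have "\<dots> \<in> integer_lattice"
      using that fl ab by (auto intro!: integer_lattice_diff)
    finally show ?thesis
      using frac_ge_0 frac_lt_1 less_imp_le by blast
  qed
  have "\<not> r > 2"
  proof
    assume "r > 2"
    moreover obtain p1 p2 q1 q2 where "0 \<le> p1" "p1 \<le> 1" "0 \<le> p2" "p2 \<le> 1"
      "p1 *\<^sub>R a + p2 *\<^sub>R b + (1 / r) *\<^sub>R c \<in> integer_lattice"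
      "0 \<le> q1" "q1 \<le> 1" "0 \<le> q2" "q2 \<le> 1"
      "q1 *\<^sub>R a + q2 *\<^sub>R b + (2 / r) *\<^sub>R c \<in> integer_lattice"
      using layer[of 1] layer[of 2] by auto
    ultimately show False
      using tight_triple_no_two_points[OF assms, of p1 p2 q1 q2 "1 / r" "2 / r"] r
      by (simp add: divide_strict_right_mono)
  qed
  moreover obtain z where z: "r = of_int z"
    using r by (auto elim: Ints_cases)
  ultimately have "z = 1 \<or> z = 2"
    using r by auto
  then consider "r = 1" | "r = 2"
    using z by auto
  then show ?thesis
  proof cases
    case 1
    \<comment> \<open>At height 1, \<open>c\<close> differs from \<open>f\<close> by an integer
      combination of \<open>a\<close> and \<open>b\<close>, so it replaces \<open>f\<close> in the
      basis.\<close>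
    have ints: "s \<in> \<int> \<and> t \<in> \<int> \<and> u \<in> \<int>" if "s *\<^sub>R a + t *\<^sub>R b + u *\<^sub>R c \<in> integer_lattice" for s t u
    proof -
      have "s *\<^sub>R a + t *\<^sub>R b + u *\<^sub>R c = (s + u * p) *\<^sub>R a + (t + u * q) *\<^sub>R b + u *\<^sub>R f"
        by (simp add: c 1 algebra_simps)
      then have *: "s + u * p \<in> \<int>" "t + u * q \<in> \<int>" "u \<in> \<int>"
        using lattice_basis_coordinates[OF f, of "s + u * p" "t + u * q" u] that by simp_all
      then have "s + u * p - u * p \<in> \<int>" "t + u * q - u * q \<in> \<int>"
        using int by (auto intro!: Ints_diff)
      then show ?thesis using * by simp
    qed
    show ?thesis
      using lattice_basisI[OF ab abc ints] by blast
  next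
    case 2
    have half: "of_int k / 2 \<in> (\<int> :: real set) \<longleftrightarrow> even k" for k
    proof
      assume "of_int k / 2 \<in> (\<int> :: real set)"
      then obtain m where "of_int k / 2 = (of_int m :: real)"
        by (auto elim: Ints_cases)
      then have "of_int k = (of_int (2 * m) :: real)"
        by simp
      then have "k = 2 * m"
        using of_int_eq_iff by blast
      then show "even k" by simp
    qed auto
    obtain m n where mn: "p = of_int m" "q = of_int n"
      using int by (auto elim!: Ints_cases)
    \<comment> \<open>For even \<open>n\<close> the lattice point
      \<open>f + (q / 2) *\<^sub>R b\<close> would lie in the plane of \<open>a, c\<close> with
      coordinate \<open>1 / 2\<close> at \<open>c\<close>, contradicting the result on pairs. The
      parity of \<open>m\<close> is settled symmetrically.\<close>
    have "odd n"
    proof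
      assume "even n"
      have "f + (q / 2) *\<^sub>R b = (- (p / 2)) *\<^sub>R a + (1 / 2) *\<^sub>R c"
        by (simp add: fc 2)
      moreover have "f + (q / 2) *\<^sub>R b \<in> integer_lattice"
        using fl ab \<open>even n\<close> half mn by simp
      ultimately have "1 / 2 \<in> (\<int> :: real set)"
        using pair[OF assms(2,4) crs(2)] by metis
      then show False
        using half[of 1] by simp
    qed
    moreover have "odd m"
    proof
      assume "even m"
      have "f + (p / 2) *\<^sub>R a = (- (q / 2)) *\<^sub>R b + (1 / 2) *\<^sub>R c"
        by (simp add: fc 2)
      moreover have "f + (p / 2) *\<^sub>R a \<in> integer_lattice"
        using fl ab \<open>even m\<close> half mn by simp
      ultimately have "1 / 2 \<in> (\<int> :: real set)"
        using pair[OF assms(3,4) crs(3)] by metis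
      then show False
        using half[of 1] by simp
    qed
    ultimately have pq: "(p + 1) / 2 \<in> \<int>" "(q + 1) / 2 \<in> \<int>"
      using half[of "m + 1"] half[of "n + 1"] mn by simp_all
    \<comment> \<open>As \<open>p\<close> and \<open>q\<close> are odd, \<open>h\<close> differs
      from \<open>f\<close> by an integer combination of \<open>a\<close> and
      \<open>b\<close>.\<close>
    define h where "h = (1/2) *\<^sub>R (a + b + c)"
    have h: "h = ((p + 1) / 2) *\<^sub>R a + ((q + 1) / 2) *\<^sub>R b + f"
      by (simp add: h_def c 2 algebra_simps add_divide_distrib)
    have ints: "s \<in> \<int> \<and> t \<in> \<int> \<and> u \<in> \<int>" if "s *\<^sub>R a + t *\<^sub>R b + u *\<^sub>R h \<in> integer_lattice" for s t u
    proof -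
      have "s *\<^sub>R a + t *\<^sub>R b + u *\<^sub>R h = (s + u * ((p + 1) / 2)) *\<^sub>R a + (t + u * ((q + 1) / 2)) *\<^sub>R b + u *\<^sub>R f"
        unfolding h by (simp add: algebra_simps)
      then have *: "s + u * ((p + 1) / 2) \<in> \<int>" "t + u * ((q + 1) / 2) \<in> \<int>" "u \<in> \<int>"
        using lattice_basis_coordinates[OF f, of "s + u * ((p + 1) / 2)" "t + u * ((q + 1) / 2)" u] that
        by simp_all
      then have "s + u * ((p + 1) / 2) - u * ((p + 1) / 2) \<in> \<int>" "t + u * ((q + 1) / 2) - u * ((q + 1) / 2) \<in> \<int>"
        using pq by (blast intro: Ints_diff Ints_mult)+
      then show ?thesis using * by simp
    qed
    moreover have "h \<in> integer_lattice"
      using pq fl ab unfolding h by simp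
    moreover have "triple a b h \<noteq> 0"
      using abc by (simp add: h_def)
    ultimately have "lattice_basis a b h"
      using ab(1,2) lattice_basisI by blast
    then show ?thesis
      by (simp add: h_def)
  qed
qed

subsection \<open>Classification of the directions\<close>

definition signed :: "'a::group_add set \<Rightarrow> 'a set" where
  "signed W = {v. v \<in> W \<or> - v \<in> W}"

lemma half_notin_Ints: "(1 / 2 :: real) \<notin> \<int>"
proof
  assume "(1 / 2 :: real) \<in> \<int>"
  then obtain k where "(1 / 2 :: real) = of_int k"
    by (rule Ints_cases)
  then have "of_int (2 * k) = (of_int 1 :: real)"
    by simp
  then have "2 * k = 1"
    using of_int_eq_iff by blast
  then show False
    by presburger
qed

text \<open>The integers \<open>2 * r\<close> and \<open>1 / r\<close> have product 2. The value 0
  appears because \<open>1 / 0 = 0\<close>.\<close>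

lemma half_integer_divisor:
  fixes r :: real
  assumes "2 * r \<in> \<int>" "1 / r \<in> \<int>"
  shows "r \<in> {0, 1, -1, 1/2, -1/2}"
proof (cases "r = 0")
  case False
  obtain m n where mn: "2 * r = of_int m" "1 / r = of_int n"
    using assms by (auto elim!: Ints_cases)
  have "of_int (m * n) = (of_int 2 :: real)"
    unfolding of_int_mult mn[symmetric] using False by simp
  then have "m * n = 2"
    using of_int_eq_iff by blast
  then have "m dvd 2"
    by (metis dvd_triv_left)
  then have "\<bar>m\<bar> \<le> 2" "m \<noteq> 0"
    using dvd_imp_le_int[of 2 m] by auto
  then have "m \<in> {1, -1, 2, -2}"
    by auto
  then show ?thesis
    using mn(1) by auto
qed simp

lemma integer_divisor:
  fixes r :: real
  assumes "r \<in> \<int>" "1 / r \<in> \<int>"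
  shows "r \<in> {0, 1, -1}"
proof -
  have "(- 1 / 2 :: real) \<notin> \<int>"
    using half_notin_Ints Ints_minus[of "- 1 / 2 :: real"] by auto
  then have "r \<noteq> 1 / 2" "r \<noteq> - 1 / 2"
    using assms(1) half_notin_Ints by blast+
  moreover have "2 * r \<in> \<int>"
    using assms(1) by simp
  ultimately show ?thesis
    using half_integer_divisor[of r] assms(2) by blast
qed

lemma triple_rotate: "triple b c a = triple a b c"
  by (simp add: triple_def inner_vec_def sum_3 cross_components algebra_simps)

lemma lattice_basis_shear:
  assumes "lattice_basis a b c" "m \<in> \<int>" "n \<in> \<int>"
  shows "lattice_basis a b (c + m *\<^sub>R a + n *\<^sub>R b)"
proof (rule lattice_basisI)
  fix p q r
  assume "p *\<^sub>R a + q *\<^sub>R b + r *\<^sub>R (c + m *\<^sub>R a + n *\<^sub>R b) \<in> integer_lattice"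
  also have "p *\<^sub>R a + q *\<^sub>R b + r *\<^sub>R (c + m *\<^sub>R a + n *\<^sub>R b) =
      (p + r * m) *\<^sub>R a + (q + r * n) *\<^sub>R b + r *\<^sub>R c"
    by (simp add: algebra_simps)
  finally have *: "p + r * m \<in> \<int> \<and> q + r * n \<in> \<int> \<and> r \<in> \<int>"
    by (rule lattice_basis_coordinates[OF assms(1)])
  then have "p + r * m - r * m \<in> \<int>" "q + r * n - r * n \<in> \<int>"
    using assms(2,3) by (blast intro: Ints_diff Ints_mult)+
  then show "p \<in> \<int> \<and> q \<in> \<int> \<and> r \<in> \<int>"
    using * by simp
qed (use lattice_basisD[OF assms(1)] assms(2,3) in simp_all)

lemma lattice_basis_standard: "lattice_basis e1 e2 e3"
proof (rule lattice_basisI)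
  fix p q r
  assume "p *\<^sub>R e1 + q *\<^sub>R e2 + r *\<^sub>R e3 \<in> integer_lattice"
  then show "p \<in> \<int> \<and> q \<in> \<int> \<and> r \<in> \<int>"
    by (simp add: integer_lattice_def forall_3 axis_def)
next
  show "triple e1 e2 e3 \<noteq> 0"
    by (simp add: triple_def cross_basis inner_axis_axis)
qed simp_all

text \<open>The interface between tightness and the classification: from here on only these
  arithmetic facts about a symmetric set of directions enter.\<close>

locale rigid_directions =
  fixes S :: "(real ^ 3) set"
  assumes lattice: "S \<subseteq> integer_lattice - {0}"
    and uminus: "v \<in> S \<Longrightarrow> - v \<in> S"
    and primitive: "v \<in> S \<Longrightarrow> r *\<^sub>R v \<in> integer_lattice \<Longrightarrow> r \<in> \<int>"
    and pair: "a \<in> S \<Longrightarrow> b \<in> S \<Longrightarrow> cross3 a b \<noteq> 0 \<Longrightarrow>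
      p *\<^sub>R a + q *\<^sub>R b \<in> integer_lattice \<Longrightarrow> p \<in> \<int> \<and> q \<in> \<int>"
    and basis: "a \<in> S \<Longrightarrow> b \<in> S \<Longrightarrow> c \<in> S \<Longrightarrow> triple a b c \<noteq> 0 \<Longrightarrow>
      lattice_basis a b c \<or> lattice_basis a b ((1/2) *\<^sub>R (a + b + c))"

lemma rigid_directions_tight:
  fixes vs :: "(real ^ 3) list"
  assumes "tight vs"
  shows "rigid_directions (directions vs)"
proof
  show "directions vs \<subseteq> integer_lattice - {0}"
    using assms by (rule tight_directions)
  show "r \<in> \<int>" if "v \<in> directions vs" "r *\<^sub>R v \<in> integer_lattice" for r v
    using assms that by (rule tight_primitive)
  show "p \<in> \<int> \<and> q \<in> \<int>" if "a \<in> directions vs" "b \<in> directions vs" "cross3 a b \<noteq> 0"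
    "p *\<^sub>R a + q *\<^sub>R b \<in> integer_lattice" for a b p q
    using assms that by (rule tight_pair)
  show "lattice_basis a b c \<or> lattice_basis a b ((1/2) *\<^sub>R (a + b + c))"
    if "a \<in> directions vs" "b \<in> directions vs" "c \<in> directions vs" "triple a b c \<noteq> 0" for a b c
    using assms that by (rule tight_triple)
qed simp

context rigid_directions
begin

lemma in_lattice: "v \<in> S \<Longrightarrow> v \<in> integer_lattice"
  using lattice by blast

text \<open>Primitivity of both vectors makes their ratio and its inverse integers.\<close>

lemma parallel:
  assumes "v \<in> S" "w \<in> S" "cross3 v w = 0"
  shows "w = v \<or> w = - v"
proof -
  have nz: "v \<noteq> 0" "w \<noteq> 0"
    using assms lattice by auto
  have "collinear {0, v, w}"
    using assms(3) cross_eq_0 by blast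
  then obtain r where r: "w = r *\<^sub>R v"
    using nz by (auto simp: collinear_lemma)
  then have "v = (1 / r) *\<^sub>R w"
    using nz by auto
  then have "r \<in> \<int>" "1 / r \<in> \<int>"
    using primitive[OF assms(1), of r] primitive[OF assms(2), of "1 / r"] in_lattice assms r by auto
  then show ?thesis
    using integer_divisor[of r] r nz by auto
qed

text \<open>Distinct directions are distinct modulo 2.\<close>

lemma midpoint:
  assumes "v \<in> S" "w \<in> S" "(1/2) *\<^sub>R (v + w) \<in> integer_lattice"
  shows "w = v \<or> w = - v"
proof (rule ccontr)
  assume "\<not> (w = v \<or> w = - v)"
  then have "cross3 v w \<noteq> 0"
    using parallel assms by blast
  moreover have "(1/2) *\<^sub>R v + (1/2) *\<^sub>R w \<in> integer_lattice"
    using assms(3) by (simp add: scaleR_add_right)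
  ultimately show False
    using pair[OF assms(1,2)] half_notin_Ints by blast
qed

section \<open>Directions in the presence of a triple of index 2\<close>

text \<open>In the basis \<open>a, b, h\<close> the vector has coordinates
  \<open>p - r, q - r, 2 * r\<close>, which are therefore integers. If \<open>r\<close> is nonzero,
  exchanging \<open>c\<close> for the vector gives another independent triple of directions, whose
  alternatives both force \<open>1 / r\<close> to be an integer.\<close>

lemma half_case_coordinate:
  assumes "a \<in> S" "b \<in> S" "c \<in> S" "triple a b c \<noteq> 0"
    and h: "(1/2) *\<^sub>R (a + b + c) \<in> integer_lattice"
    and v: "p *\<^sub>R a + q *\<^sub>R b + r *\<^sub>R c \<in> S"
  shows "r \<in> {0, 1, -1, 1/2, -1/2} \<and> p - r \<in> \<int> \<and> q - r \<in> \<int>"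
proof -
  define h where "h = (1/2) *\<^sub>R (a + b + c)"
  define w where "w = p *\<^sub>R a + q *\<^sub>R b + r *\<^sub>R c"
  have "(1/2) *\<^sub>R a + (1/2) *\<^sub>R b + (1/2) *\<^sub>R c \<in> integer_lattice"
    using h by (simp add: scaleR_add_right)
  then have "\<not> lattice_basis a b c"
    using lattice_basis_coordinates half_notin_Ints by blast
  then have bh: "lattice_basis a b h"
    using basis[OF assms(1-4)] by (simp add: h_def)
  have "w = (p - r) *\<^sub>R a + (q - r) *\<^sub>R b + (2 * r) *\<^sub>R h"
    by (simp add: w_def h_def algebra_simps)
  then have "(p - r) *\<^sub>R a + (q - r) *\<^sub>R b + (2 * r) *\<^sub>R h \<in> integer_lattice"
    using in_lattice[OF v] by (simp only: w_def)
  then have int: "p - r \<in> \<int> \<and> q - r \<in> \<int> \<and> 2 * r \<in> \<int>"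
    by (rule lattice_basis_coordinates[OF bh])
  have "1 / r \<in> \<int>"
  proof (cases "r = 0")
    case False
    have "triple a b w \<noteq> 0"
      using False assms(4) by (simp add: w_def)
    then consider "lattice_basis a b w" | "lattice_basis a b ((1/2) *\<^sub>R (a + b + w))"
      using basis[OF assms(1,2)] v unfolding w_def by blast
    then show ?thesis
    proof cases
      case 1
      have "c = (- (p / r)) *\<^sub>R a + (- (q / r)) *\<^sub>R b + (1 / r) *\<^sub>R w"
        using False by (simp add: w_def algebra_simps)
      then show ?thesis
        using lattice_basis_coordinates[OF 1] in_lattice[OF assms(3)] by metis
    next
      case 2
      \<comment> \<open>In the index-2 alternative \<open>h\<close> replaces \<open>c\<close> as the
        witness: its coordinate at the new half-sum is again \<open>1 / r\<close>.\<close>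
      have "h = ((1 - p / r) / 2 - 1 / (2 * r)) *\<^sub>R a + ((1 - q / r) / 2 - 1 / (2 * r)) *\<^sub>R b
          + (1 / r) *\<^sub>R ((1/2) *\<^sub>R (a + b + w))"
        using False by (simp add: h_def w_def algebra_simps diff_divide_distrib)
      then show ?thesis
        using lattice_basis_coordinates[OF 2] h unfolding h_def[symmetric] by metis
    qed
  qed simp
  then show ?thesis
    using half_integer_divisor int by blast
qed

text \<open>By symmetry all coordinates are bounded, and they agree modulo 1. Either all are
  \<open>1/2\<close> or \<open>-1/2\<close>, or all are \<open>0, 1, -1\<close>; in the latter case
  parity leaves exactly one nonzero coordinate.\<close>

lemma half_case:
  assumes abc: "a \<in> S" "b \<in> S" "c \<in> S" "triple a b c \<noteq> 0"
    and h: "(1/2) *\<^sub>R (a + b + c) \<in> integer_lattice"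
    and v: "v \<in> S"
  shows "v \<in> signed {a, b, c} \<or>
    (\<exists>p q r. {p, q, r} \<subseteq> {1, -1} \<and> v = (p / 2) *\<^sub>R a + (q / 2) *\<^sub>R b + (r / 2) *\<^sub>R c)"
proof -
  obtain p q r where pqr: "v = p *\<^sub>R a + q *\<^sub>R b + r *\<^sub>R c"
    using triple_coordinates abc by blast
  have v': "p *\<^sub>R a + q *\<^sub>R b + r *\<^sub>R c \<in> S" "p *\<^sub>R a + r *\<^sub>R c + q *\<^sub>R b \<in> S"
    "q *\<^sub>R b + r *\<^sub>R c + p *\<^sub>R a \<in> S"
    using v by (simp_all add: pqr ac_simps)
  have h': "(1/2) *\<^sub>R (a + c + b) \<in> integer_lattice" "(1/2) *\<^sub>R (b + c + a) \<in> integer_lattice"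
    using h by (simp_all only: ac_simps)
  have t': "triple a c b \<noteq> 0" "triple b c a \<noteq> 0"
    using abc(4) triple_swap(2)[of a b c] triple_rotate[of b c a] by simp_all
  have coords: "r \<in> {0, 1, -1, 1/2, -1/2}" "q \<in> {0, 1, -1, 1/2, -1/2}" "p \<in> {0, 1, -1, 1/2, -1/2}"
    "p - r \<in> \<int>" "q - r \<in> \<int>"
    using half_case_coordinate[OF abc h v'(1)]
      half_case_coordinate[OF abc(1,3,2) t'(1) h'(1) v'(2)]
      half_case_coordinate[OF abc(2,3,1) t'(2) h'(2) v'(3)] by blast+
  have nhalf: "- 1 / 2 \<notin> (\<int> :: real set)" "1 / 2 \<notin> (\<int> :: real set)"
    using half_notin_Ints Ints_minus[of "- 1 / 2 :: real"] by auto
  show ?thesis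
  proof (cases "r \<in> \<int>")
    case False
    then have "r \<in> {1/2, -1/2}"
      using coords by auto
    moreover have "q \<notin> \<int>" "p \<notin> \<int>"
      using False coords Ints_diff[of q "q - r"] Ints_diff[of p "p - r"] by auto
    then have "q \<in> {1/2, -1/2}" "p \<in> {1/2, -1/2}"
      using coords by auto
    ultimately have "{2 * p, 2 * q, 2 * r} \<subseteq> {1, -1}"
      by auto
    moreover have "v = (2 * p / 2) *\<^sub>R a + (2 * q / 2) *\<^sub>R b + (2 * r / 2) *\<^sub>R c"
      by (simp add: pqr)
    ultimately show ?thesis
      by blast
  next
    case True
    then have "q \<in> \<int>" "p \<in> \<int>"
      using coords Ints_add[of "q - r" r] Ints_add[of "p - r" r] by auto
    then have pqr': "p \<in> {0, 1, -1}" "q \<in> {0, 1, -1}" "r \<in> {0, 1, -1}"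
      using coords True nhalf by blast+
    \<comment> \<open>All signed sums of \<open>a, b, c\<close> are twice lattice points, since
      changing a sign changes the sum by an even vector.\<close>
    have even: "(1/2) *\<^sub>R (i *\<^sub>R a + j *\<^sub>R b + k *\<^sub>R c) \<in> integer_lattice"
      if "{i, j, k} \<subseteq> {1, -1}" for i j k
    proof -
      have "(1/2) *\<^sub>R (i *\<^sub>R a + j *\<^sub>R b + k *\<^sub>R c) =
        (1/2) *\<^sub>R (a + b + c) - ((1 - i) / 2) *\<^sub>R a - ((1 - j) / 2) *\<^sub>R b - ((1 - k) / 2) *\<^sub>R c"
        by (simp add: algebra_simps diff_divide_distrib)
      moreover have "(1 - i) / 2 \<in> \<int>" "(1 - j) / 2 \<in> \<int>" "(1 - k) / 2 \<in> \<int>"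
        using that by auto
      ultimately show ?thesis
        using h abc in_lattice by simp
    qed
    \<comment> \<open>With two nonzero coordinates, \<open>v\<close> would agree modulo 2 with the
      missing third vector, hence equal it up to sign, contradicting independence.\<close>
    have two: "v \<noteq> i *\<^sub>R a + j *\<^sub>R b" "v \<noteq> i *\<^sub>R a + j *\<^sub>R c" "v \<noteq> i *\<^sub>R b + j *\<^sub>R c"
      if "{i, j} \<subseteq> {1, -1}" for i j
    proof -
      show "v \<noteq> i *\<^sub>R a + j *\<^sub>R b"
      proof
        assume *: "v = i *\<^sub>R a + j *\<^sub>R b"
        then have "c = v \<or> c = - v"
          using midpoint[of v c] even[of i j 1] abc v that by (simp add: algebra_simps)
        then have "triple a b c = 0"
          using * by auto
        then show False using abc by simp
      qed
      show "v \<noteq> i *\<^sub>R a + j *\<^sub>R c"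
      proof
        assume *: "v = i *\<^sub>R a + j *\<^sub>R c"
        then have "b = v \<or> b = - v"
          using midpoint[of v b] even[of i 1 j] abc v that by (simp add: algebra_simps)
        then have "triple a b c = 0"
          using * by auto
        then show False using abc by simp
      qed
      show "v \<noteq> i *\<^sub>R b + j *\<^sub>R c"
      proof
        assume *: "v = i *\<^sub>R b + j *\<^sub>R c"
        then have "a = v \<or> a = - v"
          using midpoint[of v a] even[of 1 i j] abc v that by (simp add: algebra_simps)
        then have "triple a b c = 0"
          using * by auto
        then show False using abc by simp
      qed
    qed
    \<comment> \<open>With three nonzero coordinates \<open>v\<close> would be twice a lattice
      point, contradicting primitivity.\<close>
    have "\<not> {p, q, r} \<subseteq> {1, -1}"
      using even[of p q r] primitive[OF v, of "1/2"] half_notin_Ints unfolding pqr by blast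
    moreover have "v \<noteq> 0"
      using v lattice by blast
    ultimately have "v \<in> signed {a, b, c}"
      using pqr' two[of p q] two[of p r] two[of q r] unfolding pqr signed_def by auto
    then show ?thesis ..
  qed
qed

lemma classify_half_case:
  assumes abc: "a \<in> S" "b \<in> S" "c \<in> S" "triple a b c \<noteq> 0" "\<not> lattice_basis a b c"
  shows "\<exists>f1 f2 f3. lattice_basis f1 f2 f3 \<and>
    S \<subseteq> signed {f1, f2, f1 + f2 + 2 *\<^sub>R f3, f1 + f2 + f3, f1 + f3, f2 + f3, f3}"
proof (intro exI conjI subsetI)
  \<comment> \<open>Thus \<open>f\<close> is half of \<open>c - a - b\<close>, so that
    \<open>c = a + b + 2 *\<^sub>R f\<close>, and the half-sums become, up to sign,
    \<open>f\<close>, \<open>a + f\<close>, \<open>b + f\<close> and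
    \<open>a + b + f\<close>.\<close>
  define f where "f = (1/2) *\<^sub>R (a + b + c) + (- 1) *\<^sub>R a + (- 1) *\<^sub>R b"
  have bh: "lattice_basis a b ((1/2) *\<^sub>R (a + b + c))"
    using basis abc by blast
  then show "lattice_basis a b f"
    unfolding f_def by (intro lattice_basis_shear) auto
  fix v assume "v \<in> S"
  from half_case[OF abc(1-4) lattice_basisD(3)[OF bh] this]
  \<comment> \<open>Writing \<open>a, b, c\<close> with doubled coefficients gives both alternatives
    of \<open>half_case\<close> the same shape.\<close>
  obtain p q r where pqr: "v = (p / 2) *\<^sub>R a + (q / 2) *\<^sub>R b + (r / 2) *\<^sub>R c"
    "(p, q, r) \<in> {(2,0,0), (-2,0,0), (0,2,0), (0,-2,0), (0,0,2), (0,0,-2)} \<or> {p, q, r} \<subseteq> {1, -1}"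
  proof
    assume "v \<in> signed {a, b, c}"
    then have "v \<in> {a, - a, b, - b, c, - c}"
      by (auto simp: signed_def minus_equation_iff[of v])
    then show thesis
      using that[of 2 0 0] that[of "-2" 0 0] that[of 0 2 0] that[of 0 "-2" 0] that[of 0 0 2] that[of 0 0 "-2"]
      by auto
  qed (use that in blast)
  have v: "v = ((p + r) / 2) *\<^sub>R a + ((q + r) / 2) *\<^sub>R b + r *\<^sub>R f"
    unfolding pqr(1) by (simp add: f_def vec_eq_iff field_simps)
  have mv: "- v = (- (p + r) / 2) *\<^sub>R a + (- (q + r) / 2) *\<^sub>R b + (- r) *\<^sub>R f"
    unfolding v by (simp add: vec_eq_iff field_simps)
  show "v \<in> signed {a, b, a + b + 2 *\<^sub>R f, a + b + f, a + f, b + f, f}"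
    using pqr(2)
  proof
    assume "(p, q, r) \<in> {(2,0,0), (-2,0,0), (0,2,0), (0,-2,0), (0,0,2), (0,0,-2)}"
    then show ?thesis
      unfolding signed_def mem_Collect_eq mv unfolding v by (elim insertE emptyE) simp_all
  next
    assume "{p, q, r} \<subseteq> {1, -1}"
    then have "p \<in> {1, -1}" "q \<in> {1, -1}" "r \<in> {1, -1}"
      by simp_all
    then show ?thesis
      unfolding signed_def mem_Collect_eq mv unfolding v by (elim insertE emptyE) simp_all
  qed
qed

end

section \<open>Directions when all independent triples are unimodular\<close>

definition second_form :: "real ^ 3 \<Rightarrow> real ^ 3 \<Rightarrow> real ^ 3 \<Rightarrow> real ^ 3 \<Rightarrow> (real ^ 3) set" where
  "second_form f1 f2 f3 w = {f1, f2, f3, f1 + f2 + f3, w, f1 + f3, f2 + f3}"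

text \<open>A finite check. Of the 26 nonzero vectors with coordinates \<open>0, 1, -1\<close>, 18
  have a zero coordinate; the six excluded differences or sums leave 12, which are the six remaining
  generators up to sign.\<close>

lemma mem_signed_second_form:
  assumes "p \<in> {0, 1, -1}" "q \<in> {0, 1, -1}" "r \<in> {0, 1, -1}" "v = p *\<^sub>R a + q *\<^sub>R b + r *\<^sub>R c"
    and "v \<noteq> 0"
    and "\<not> {p, q, r} \<subseteq> {1, -1}"
    and "v \<noteq> a - c" "v \<noteq> c - a" "v \<noteq> b - c" "v \<noteq> c - b"
    and w: "w = a + b \<and> v \<noteq> a - b \<and> v \<noteq> b - a \<or> w = a - b \<and> v \<noteq> a + b \<and> v \<noteq> - a - b"
  shows "v \<in> signed (second_form a b c w)"
proof -
  have mv: "- v = (- p) *\<^sub>R a + (- q) *\<^sub>R b + (- r) *\<^sub>R c"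
    unfolding assms(4) by simp
  show ?thesis
    using assms(1-3,5-) unfolding signed_def mem_Collect_eq mv second_form_def unfolding assms(4)
    by (elim insertE emptyE) auto
qed

context rigid_directions
begin

lemma signed_multiple: "v \<in> S \<Longrightarrow> i \<in> {1, -1} \<Longrightarrow> i *\<^sub>R v \<in> S"
  using uminus[of v] by auto

text \<open>The vectors \<open>a + b\<close> and \<open>a - b\<close> agree modulo 2, their midpoint
  being \<open>a\<close>.\<close>

lemma opposite_not_sum:
  assumes "a \<in> S" "b \<in> S" "cross3 a b \<noteq> 0" "a + b \<in> S"
  shows "a - b \<notin> S"
proof
  assume "a - b \<in> S"
  moreover have "(1/2) *\<^sub>R ((a + b) + (a - b)) = a"
    by (simp add: vec_eq_iff)
  ultimately have "a - b = a + b \<or> a - b = - (a + b)"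
    using midpoint[of "a + b" "a - b"] assms in_lattice by simp
  then have "b = 0 \<or> a = 0"
    by (auto simp: vec_eq_iff)
  then show False
    using assms(3) by auto
qed

text \<open>Exchanging \<open>c\<close> for the vector gives a basis again, so both \<open>r\<close>
  and, if \<open>r\<close> is nonzero, \<open>1 / r\<close> are integers.\<close>

lemma unimodular_coordinate:
  assumes "a \<in> S" "b \<in> S" "c \<in> S" "triple a b c \<noteq> 0"
    and U: "\<forall>x \<in> S. \<forall>y \<in> S. \<forall>z \<in> S. triple x y z \<noteq> 0 \<longrightarrow> lattice_basis x y z"
    and v: "p *\<^sub>R a + q *\<^sub>R b + r *\<^sub>R c \<in> S"
  shows "r \<in> {0, 1, -1}"
proof (cases "r = 0")
  case False
  define w where "w = p *\<^sub>R a + q *\<^sub>R b + r *\<^sub>R c"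
  have "triple a b w \<noteq> 0"
    using False assms(4) by (simp add: w_def)
  then have "lattice_basis a b w"
    using assms(1,2) v U unfolding w_def by blast
  moreover have "c = (- (p / r)) *\<^sub>R a + (- (q / r)) *\<^sub>R b + (1 / r) *\<^sub>R w"
    using False by (simp add: w_def algebra_simps)
  ultimately have "1 / r \<in> \<int>"
    using lattice_basis_coordinates in_lattice[OF assms(3)] by metis
  moreover have "lattice_basis a b c"
    using U assms(1-4) by blast
  then have "r \<in> \<int>"
    using lattice_basis_coordinates[OF _ in_lattice[OF v]] by blast
  ultimately show ?thesis
    by (rule integer_divisor[rotated])
qed simp

lemma unimodular_coordinates:
  assumes abc: "a \<in> S" "b \<in> S" "c \<in> S" "triple a b c \<noteq> 0"
    and U: "\<forall>x \<in> S. \<forall>y \<in> S. \<forall>z \<in> S. triple x y z \<noteq> 0 \<longrightarrow> lattice_basis x y z"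
    and v: "v \<in> S"
  obtains p q r where "p \<in> {0, 1, -1}" "q \<in> {0, 1, -1}" "r \<in> {0, 1, -1}"
    "v = p *\<^sub>R a + q *\<^sub>R b + r *\<^sub>R c"
proof -
  obtain p q r where pqr: "v = p *\<^sub>R a + q *\<^sub>R b + r *\<^sub>R c"
    using triple_coordinates abc by blast
  have v': "p *\<^sub>R a + q *\<^sub>R b + r *\<^sub>R c \<in> S" "p *\<^sub>R a + r *\<^sub>R c + q *\<^sub>R b \<in> S"
    "q *\<^sub>R b + r *\<^sub>R c + p *\<^sub>R a \<in> S"
    using v by (simp_all add: pqr ac_simps)
  have t': "triple a c b \<noteq> 0" "triple b c a \<noteq> 0"
    using abc(4) triple_swap(2)[of a b c] triple_rotate[of b c a] by simp_all
  show ?thesis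
    using unimodular_coordinate[OF abc(1,3,2) t'(1) U v'(2)]
      unimodular_coordinate[OF abc(2,3,1) t'(2) U v'(3)] unimodular_coordinate[OF abc U v'(1)] pqr
    by (intro that)
qed

text \<open>Otherwise \<open>a - b\<close>, \<open>c\<close> and \<open>a + b + c\<close> would be
  an independent triple of index 2, in which \<open>a\<close> has half-integral coordinates.\<close>

lemma unimodular_difference:
  assumes "a \<in> S" "b \<in> S" "c \<in> S" "triple a b c \<noteq> 0" "a + b + c \<in> S"
    and U: "\<forall>x \<in> S. \<forall>y \<in> S. \<forall>z \<in> S. triple x y z \<noteq> 0 \<longrightarrow> lattice_basis x y z"
  shows "a - b \<notin> S"
proof
  assume *: "a - b \<in> S"
  have "triple (a - b) c (a + b + c) \<noteq> 0"
    using assms(4) triple_swap(2)[of a b c] triple_rotate[of b c a] by simp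
  then have "lattice_basis (a - b) c (a + b + c)"
    using U * assms(3,5) by blast
  moreover have "a = (1/2) *\<^sub>R (a - b) + (- 1/2) *\<^sub>R c + (1/2) *\<^sub>R (a + b + c)"
    by (simp add: vec_eq_iff field_simps)
  ultimately have "1/2 \<in> (\<int> :: real set)"
    using lattice_basis_coordinates in_lattice[OF assms(1)] by metis
  then show False
    using half_notin_Ints by simp
qed

text \<open>With \<open>a + b + c\<close> present, all differences of two basis vectors are
  excluded, and any other vector with three nonzero coordinates would agree with
  \<open>a + b + c\<close> modulo 2.\<close>

lemma classify_unimodular_sum:
  assumes abc: "a \<in> S" "b \<in> S" "c \<in> S" "triple a b c \<noteq> 0" "a + b + c \<in> S"
    and U: "\<forall>x \<in> S. \<forall>y \<in> S. \<forall>z \<in> S. triple x y z \<noteq> 0 \<longrightarrow> lattice_basis x y z"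
  shows "S \<subseteq> signed (second_form a b c (a + b))"
proof
  fix v assume v: "v \<in> S"
  then obtain p q r where pqr: "p \<in> {0, 1, -1}" "q \<in> {0, 1, -1}" "r \<in> {0, 1, -1}"
    "v = p *\<^sub>R a + q *\<^sub>R b + r *\<^sub>R c"
    by (rule unimodular_coordinates[OF abc(1-4) U])
  have t': "triple a c b \<noteq> 0" "triple b c a \<noteq> 0"
    using abc(4) triple_swap(2)[of a b c] triple_rotate[of b c a] by simp_all
  have s': "a + c + b \<in> S" "b + c + a \<in> S"
    using abc(5) by (simp_all add: ac_simps)
  have d: "a - b \<notin> S" "a - c \<notin> S" "b - c \<notin> S"
    using unimodular_difference[OF abc U] unimodular_difference[OF abc(1,3,2) t'(1) s'(1) U]
      unimodular_difference[OF abc(2,3,1) t'(2) s'(2) U] by blast+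
  then have d': "b - a \<notin> S" "c - a \<notin> S" "c - b \<notin> S"
    using uminus by (metis minus_diff_eq)+
  show "v \<in> signed (second_form a b c (a + b))"
  proof (cases "{p, q, r} \<subseteq> {1, -1}")
    case True
    have "(1/2) *\<^sub>R ((a + b + c) + v) = ((1 + p) / 2) *\<^sub>R a + ((1 + q) / 2) *\<^sub>R b + ((1 + r) / 2) *\<^sub>R c"
      by (simp add: pqr(4) vec_eq_iff field_simps)
    moreover have "(1 + p) / 2 \<in> \<int>" "(1 + q) / 2 \<in> \<int>" "(1 + r) / 2 \<in> \<int>"
      using True by auto
    ultimately have "(1/2) *\<^sub>R ((a + b + c) + v) \<in> integer_lattice"
      using abc in_lattice by simp
    then have "v = a + b + c \<or> v = - (a + b + c)"
      using midpoint[OF abc(5) v] by blast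
    then show ?thesis
      unfolding signed_def second_form_def by force
  next
    case False
    have "v \<noteq> 0"
      using v lattice by blast
    then show ?thesis
      using False v d d' by (intro mem_signed_second_form[OF pqr]) blast+
  qed
qed

text \<open>If some signed sum of \<open>a, b, c\<close> is a direction, sign changes turn it into
  \<open>a + b + c\<close>. Otherwise the signs of \<open>a\<close> and \<open>b\<close> are spent
  on excluding \<open>a - c\<close> and \<open>b - c\<close>; nothing is left to normalize the pair
  \<open>a, b\<close>, hence the two choices of sign.\<close>

lemma classify_unimodular:
  assumes abc: "a \<in> S" "b \<in> S" "c \<in> S" "triple a b c \<noteq> 0"
    and U: "\<forall>x \<in> S. \<forall>y \<in> S. \<forall>z \<in> S. triple x y z \<noteq> 0 \<longrightarrow> lattice_basis x y z"
  shows "\<exists>f1 f2 f3. lattice_basis f1 f2 f3 \<and>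
    (\<exists>w \<in> {f1 + f2, f1 - f2}. S \<subseteq> signed (second_form f1 f2 f3 w))"
proof (cases "\<exists>p q r. {p, q, r} \<subseteq> {1, -1} \<and> p *\<^sub>R a + q *\<^sub>R b + r *\<^sub>R c \<in> S")
  case True
  then obtain p q r where pqr: "{p, q, r} \<subseteq> {1, -1}" "p *\<^sub>R a + q *\<^sub>R b + r *\<^sub>R c \<in> S"
    by blast
  have "p *\<^sub>R a \<in> S" "q *\<^sub>R b \<in> S" "r *\<^sub>R c \<in> S"
    using pqr(1) abc by (simp_all add: signed_multiple)
  moreover have "triple (p *\<^sub>R a) (q *\<^sub>R b) (r *\<^sub>R c) \<noteq> 0"
    using pqr(1) abc(4) by auto
  ultimately have "S \<subseteq> signed (second_form (p *\<^sub>R a) (q *\<^sub>R b) (r *\<^sub>R c) (p *\<^sub>R a + q *\<^sub>R b))"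
    "lattice_basis (p *\<^sub>R a) (q *\<^sub>R b) (r *\<^sub>R c)"
    using classify_unimodular_sum[OF _ _ _ _ pqr(2) U] U by blast+
  then show ?thesis
    by blast
next
  case False
  have crs: "cross3 a c \<noteq> 0" "cross3 b c \<noteq> 0" "cross3 a b \<noteq> 0"
  proof -
    show "cross3 b c \<noteq> 0" using abc by (auto simp: triple_def)
    have "triple a b c = - (b \<bullet> cross3 a c)" "triple a b c = c \<bullet> cross3 a b"
      by (simp_all add: triple_def inner_vec_def sum_3 cross_components algebra_simps)
    then show "cross3 a b \<noteq> 0" "cross3 a c \<noteq> 0"
      using abc by auto
  qed
  \<comment> \<open>Not both \<open>x - c\<close> and \<open>x + c\<close> are directions, so one
    sign of \<open>x\<close> always avoids the difference.\<close>
  have flip: "\<exists>i \<in> {1, -1}. i *\<^sub>R x - c \<notin> S" if "x \<in> S" "cross3 x c \<noteq> 0" for x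
  proof (cases "x - c \<in> S")
    case True
    have "- x - c \<notin> S"
    proof
      assume "- x - c \<in> S"
      then have "x + c \<in> S"
        using uminus[of "- x - c"] by (simp add: add.commute)
      then show False
        using opposite_not_sum[OF that(1) abc(3) that(2)] True by blast
    qed
    then show ?thesis by simp
  qed simp
  obtain i j where ij: "i \<in> {1, -1}" "j \<in> {1, -1}" "i *\<^sub>R a - c \<notin> S" "j *\<^sub>R b - c \<notin> S"
    using flip[OF abc(1) crs(1)] flip[OF abc(2) crs(2)] by blast
  define a' b' where "a' = i *\<^sub>R a" and "b' = j *\<^sub>R b"
  have S': "a' \<in> S" "b' \<in> S" "triple a' b' c \<noteq> 0" "cross3 a' b' \<noteq> 0"
    using ij(1,2) abc crs(3)
    by (auto simp: a'_def b'_def signed_multiple cross_mult_left cross_mult_right simp del: scaleR_minus_left)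
  have d: "a' - c \<notin> S" "b' - c \<notin> S"
    using ij by (simp_all add: a'_def b'_def)
  then have d': "c - a' \<notin> S" "c - b' \<notin> S"
    using uminus by (metis minus_diff_eq)+
  have full: "p *\<^sub>R a' + q *\<^sub>R b' + r *\<^sub>R c \<notin> S" if "{p, q, r} \<subseteq> {1, -1}" for p q r
  proof -
    have "{p * i, q * j, r} \<subseteq> {1, -1}"
      using that ij by auto
    then have "(p * i) *\<^sub>R a + (q * j) *\<^sub>R b + r *\<^sub>R c \<notin> S"
      using False by blast
    then show ?thesis
      by (simp add: a'_def b'_def)
  qed
  define w where "w = (if a' + b' \<in> S then a' + b' else a' - b')"
  have w: "w = a' + b' \<and> a' - b' \<notin> S \<or> w = a' - b' \<and> a' + b' \<notin> S"
    using opposite_not_sum[OF S'(1,2,4)] by (simp add: w_def)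
  then have w': "w = a' + b' \<and> a' - b' \<notin> S \<and> b' - a' \<notin> S \<or>
      w = a' - b' \<and> a' + b' \<notin> S \<and> - a' - b' \<notin> S"
    using uminus[of "b' - a'"] uminus[of "- a' - b'"] by (auto simp: add.commute)
  have "S \<subseteq> signed (second_form a' b' c w)"
  proof
    fix v assume v: "v \<in> S"
    then obtain p q r where pqr: "p \<in> {0, 1, -1}" "q \<in> {0, 1, -1}" "r \<in> {0, 1, -1}"
      "v = p *\<^sub>R a' + q *\<^sub>R b' + r *\<^sub>R c"
      by (rule unimodular_coordinates[OF S'(1,2) abc(3) S'(3) U])
    have "v \<noteq> 0" "\<not> {p, q, r} \<subseteq> {1, -1}"
      using v lattice full[of p q r] pqr(4) by auto
    moreover have "w = a' + b' \<and> v \<noteq> a' - b' \<and> v \<noteq> b' - a' \<or>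
        w = a' - b' \<and> v \<noteq> a' + b' \<and> v \<noteq> - a' - b'"
      using v w' by auto
    ultimately show "v \<in> signed (second_form a' b' c w)"
      using v d d' by (intro mem_signed_second_form[OF pqr]) blast+
  qed
  moreover have "lattice_basis a' b' c"
    using U S'(1,2,3) abc(3) by blast
  moreover have "w \<in> {a' + b', a' - b'}"
    by (simp add: w_def)
  ultimately show ?thesis
    by blast
qed

text \<open>The third basis vector need not be a direction. The unimodular argument is repeated
  inside the plane, with pairs in place of triples.\<close>

lemma classify_planar:
  assumes ab: "a \<in> S" "b \<in> S" "cross3 a b \<noteq> 0"
    and planar: "\<And>x. x \<in> S \<Longrightarrow> triple a b x = 0"
  shows "\<exists>f1 f2 f3. lattice_basis f1 f2 f3 \<and>
    (\<exists>w \<in> {f1 + f2, f1 - f2}. S \<subseteq> signed (second_form f1 f2 f3 w))"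
proof -
  obtain c where c: "lattice_basis a b c"
    using lattice_basis_completion[OF in_lattice[OF ab(1)] in_lattice[OF ab(2)] ab(3) pair[OF ab]]
    by blast
  define w where "w = (if a + b \<in> S then a + b else a - b)"
  have w: "w = a + b \<and> a - b \<notin> S \<or> w = a - b \<and> a + b \<notin> S"
    using opposite_not_sum[OF ab] by (simp add: w_def)
  then have w': "w = a + b \<and> a - b \<notin> S \<and> b - a \<notin> S \<or>
      w = a - b \<and> a + b \<notin> S \<and> - a - b \<notin> S"
    using uminus[of "b - a"] uminus[of "- a - b"] by (auto simp: add.commute)
  have "S \<subseteq> signed (second_form a b c w)"
  proof
    fix v assume v: "v \<in> S"
    obtain p q r where pqr: "v = p *\<^sub>R a + q *\<^sub>R b + r *\<^sub>R c"
      using triple_coordinates lattice_basisD(4)[OF c] by blast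
    then have "r = 0"
      using planar[OF v] lattice_basisD(4)[OF c] by simp
    then have v_eq: "v = p *\<^sub>R a + q *\<^sub>R b"
      using pqr by simp
    then have int: "p \<in> \<int>" "q \<in> \<int>"
      using pair[OF ab] in_lattice[OF v] by blast+
    have "1 / p \<in> \<int>"
    proof (cases "p = 0")
      case False
      have "cross3 v b \<noteq> 0"
        using False ab(3) by (simp add: v_eq cross_add_left cross_mult_left)
      moreover have "a = (1 / p) *\<^sub>R v + (- (q / p)) *\<^sub>R b"
        using False by (simp add: v_eq algebra_simps)
      ultimately show ?thesis
        using pair[OF v ab(2)] in_lattice[OF ab(1)] by metis
    qed simp
    then have p: "p \<in> {0, 1, -1}"
      using int(1) integer_divisor by blast
    have "1 / q \<in> \<int>"
    proof (cases "q = 0")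
      case False
      have "cross3 a v \<noteq> 0"
        using False ab(3) by (simp add: v_eq cross_add_right cross_mult_right)
      moreover have "b = (- (p / q)) *\<^sub>R a + (1 / q) *\<^sub>R v"
        using False by (simp add: v_eq algebra_simps)
      ultimately show ?thesis
        using pair[OF ab(1) v] in_lattice[OF ab(2)] by metis
    qed simp
    then have q: "q \<in> {0, 1, -1}"
      using int(2) integer_divisor by blast
    have tv: "triple a b v = 0"
      using planar[OF v] .
    have "v \<noteq> a - c" "v \<noteq> c - a" "v \<noteq> b - c" "v \<noteq> c - b"
      using tv lattice_basisD(4)[OF c] by auto
    moreover have "v \<noteq> 0"
      using v lattice by blast
    moreover have "\<not> {p, q, r} \<subseteq> {1, -1}"
      using \<open>r = 0\<close> by simp
    moreover have "r \<in> {0, 1, -1}"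
      using \<open>r = 0\<close> by simp
    moreover have "w = a + b \<and> v \<noteq> a - b \<and> v \<noteq> b - a \<or> w = a - b \<and> v \<noteq> a + b \<and> v \<noteq> - a - b"
      using v w' by auto
    ultimately show "v \<in> signed (second_form a b c w)"
      by (intro mem_signed_second_form[OF p q _ pqr])
  qed
  moreover have "w \<in> {a + b, a - b}"
    by (simp add: w_def)
  ultimately show ?thesis
    using c by blast
qed

lemma classify_line:
  assumes "\<And>x y. x \<in> S \<Longrightarrow> y \<in> S \<Longrightarrow> cross3 x y = 0"
  shows "\<exists>f1 f2 f3. lattice_basis f1 f2 f3 \<and> S \<subseteq> signed {f1}"
proof (cases "S = {}")
  case True
  then show ?thesis
    using lattice_basis_standard by blast
next
  case False
  then obtain a where a: "a \<in> S"
    by blast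
  then have "S \<subseteq> signed {a}"
    using parallel[OF a _ assms[OF a]] by (force simp: signed_def)
  moreover have "a \<noteq> 0"
    using a lattice by blast
  ultimately show ?thesis
    using lattice_basis_completion_primitive[OF in_lattice[OF a] _ primitive[OF a]] by blast
qed

lemma classification:
  "\<exists>f1 f2 f3. lattice_basis f1 f2 f3 \<and>
    (S \<subseteq> signed {f1, f2, f1 + f2 + 2 *\<^sub>R f3, f1 + f2 + f3, f1 + f3, f2 + f3, f3} \<or>
     (\<exists>w \<in> {f1 + f2, f1 - f2}. S \<subseteq> signed (second_form f1 f2 f3 w)))"
proof -
  \<comment> \<open>The cases are: a triple that is not a basis, which then has index 2; rank three
    with only unimodular triples; rank two; rank at most one.\<close>
  consider a b c where "a \<in> S" "b \<in> S" "c \<in> S" "triple a b c \<noteq> 0" "\<not> lattice_basis a b c"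
    | a b c where "a \<in> S" "b \<in> S" "c \<in> S" "triple a b c \<noteq> 0"
        "\<forall>x \<in> S. \<forall>y \<in> S. \<forall>z \<in> S. triple x y z \<noteq> 0 \<longrightarrow> lattice_basis x y z"
    | a b where "a \<in> S" "b \<in> S" "cross3 a b \<noteq> 0" "\<And>x. x \<in> S \<Longrightarrow> triple a b x = 0"
    | "\<And>x y. x \<in> S \<Longrightarrow> y \<in> S \<Longrightarrow> cross3 x y = 0"
    by metis
  then show ?thesis
  proof cases
    case 1
    then show ?thesis
      using classify_half_case by blast
  next
    case (2 a b c)
    then show ?thesis
      using classify_unimodular[of a b c] by blast
  next
    case (3 a b)
    then show ?thesis
      using classify_planar[of a b] by blast
  next
    case 4
    from classify_line[OF this] obtain f1 f2 f3 where "lattice_basis f1 f2 f3" "S \<subseteq> signed {f1}"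
      by blast
    moreover have "signed {f1} \<subseteq> signed (second_form f1 f2 f3 (f1 + f2))"
      by (auto simp: signed_def second_form_def)
    ultimately show ?thesis
      by blast
  qed
qed

end

subsection \<open>Normal forms\<close>

lemma singleton_plus_eq_image: "{a} + X = (\<lambda>x. a + x) ` X"
  by (auto simp: set_plus_def)

lemma zonotope_signed:
  assumes "set vs \<subseteq> signed W" "W \<subseteq> integer_lattice"
  shows "\<exists>t us. t \<in> integer_lattice \<and> set us \<subseteq> W \<and> zonotope vs = {t} + zonotope us"
  using assms(1)
proof (induction vs)
  case Nil
  show ?case
    by (rule exI[of _ 0], rule exI[of _ "[]"]) simp
next
  case (Cons v vs)
  then obtain t us where us: "t \<in> integer_lattice" "set us \<subseteq> W" "zonotope vs = {t} + zonotope us"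
    by auto
  obtain w s where ws: "w \<in> W" "s \<in> integer_lattice" "closed_segment 0 v = {s} + closed_segment 0 w"
  proof (cases "v \<in> W")
    case True
    then show thesis using that[of v 0] by simp
  next
    case False
    then have "- v \<in> W"
      using Cons.prems by (simp add: signed_def)
    then show thesis
      using that[of "- v" v] assms(2) closed_segment_0_uminus[of "- v"] by auto
  qed
  have "zonotope (v # vs) = {s + t} + zonotope (w # us)"
    by (simp only: zonotope_Cons us(3) ws(3) add.assoc add.left_commute[of "closed_segment 0 w"]
        singleton_plus_singleton)
  then show ?case
    using us ws by (intro exI[of _ "s + t"] exI[of _ "w # us"]) auto
qed

lemma zonotope_replicate: "zonotope (replicate n v) = n \<odot> closed_segment 0 v"
  by (induction n) (simp_all add: minkowski_multiple_def add.commute)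

lemma zonotope_multiples:
  assumes "set us \<subseteq> set ws"
  shows "\<exists>ns. length ns = length ws \<and>
    zonotope us = sum_list (map2 (\<lambda>n w. n \<odot> closed_segment 0 w) ns ws)"
  using assms
proof (induction ws arbitrary: us)
  case Nil
  then show ?case by simp
next
  case (Cons w ws)
  have "set (filter (\<lambda>u. w \<noteq> u) us) \<subseteq> set ws"
    using Cons.prems by auto
  from Cons.IH[OF this] obtain ns where ns: "length ns = length ws"
    "zonotope (filter (\<lambda>u. w \<noteq> u) us) = sum_list (map2 (\<lambda>n w. n \<odot> closed_segment 0 w) ns ws)"
    by blast
  have "mset us = mset (filter (\<lambda>u. w = u) us @ filter (\<lambda>u. w \<noteq> u) us)"
    by simp
  then have "zonotope us = zonotope (filter (\<lambda>u. w = u) us @ filter (\<lambda>u. w \<noteq> u) us)"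
    by (rule zonotope_mset_eq)
  also have "filter (\<lambda>u. w = u) us = replicate (length (filter (\<lambda>u. w = u) us)) w"
    by (rule replicate_length_filter[symmetric])
  finally show ?case
    using ns by (intro exI[of _ "length (filter (\<lambda>u. w = u) us) # ns"]) (simp add: zonotope_replicate)
qed

section \<open>Passage to the standard basis\<close>

text \<open>The matrix \<open>F\<close> with columns \<open>f1, f2, f3\<close> has an integral right
  inverse \<open>M\<close>, whose columns are the integer coordinates of the standard basis vectors.
  Over the reals a one-sided inverse is two-sided, and this descends to the integers.\<close>

lemma lattice_basis_to_standard:
  assumes "lattice_basis f1 f2 f3"
  shows "\<exists>M :: int ^ 3 ^ 3. invertible M \<and> map_matrix real_of_int M *v f1 = e1 \<and>
    map_matrix real_of_int M *v f2 = e2 \<and> map_matrix real_of_int M *v f3 = e3"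
proof -
  define f where "f i = (if i = 1 then f1 else if i = 2 then f2 else f3)" for i :: 3
  have f_simps: "f 1 = f1" "f 2 = f2" "f 3 = f3"
    by (simp_all add: f_def)
  have f_lat: "f i \<in> integer_lattice" for i
    using lattice_basisD[OF assms] by (simp add: f_def)
  \<comment> \<open>The floor only changes the type: the entries are already integers.\<close>
  define F :: "int ^ 3 ^ 3" where "F = (\<chi> i j. \<lfloor>f j $ i\<rfloor>)"
  have F: "map_matrix real_of_int F = (\<chi> i j. f j $ i)"
    using f_lat by (simp add: F_def vec_eq_iff integer_lattice_def)
  have F_mult: "map_matrix real_of_int F *v x = x $ 1 *\<^sub>R f1 + x $ 2 *\<^sub>R f2 + x $ 3 *\<^sub>R f3" for x
    by (simp add: F matrix_vector_mult_def vec_eq_iff sum_3 f_simps mult.commute)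
  have "\<exists>x. x \<in> integer_lattice \<and> map_matrix real_of_int F *v x = axis j 1" for j
  proof -
    obtain p q r where pqr: "axis j 1 = p *\<^sub>R f1 + q *\<^sub>R f2 + r *\<^sub>R f3"
      using triple_coordinates lattice_basisD(4)[OF assms] by blast
    then have "p \<in> \<int> \<and> q \<in> \<int> \<and> r \<in> \<int>"
      using lattice_basis_coordinates[OF assms] integer_lattice_axis by metis
    then show ?thesis
      using pqr by (intro exI[of _ "vector [p, q, r]"]) (simp add: F_mult integer_lattice_def forall_3)
  qed
  then obtain g where g: "\<And>j. g j \<in> integer_lattice" "\<And>j. map_matrix real_of_int F *v g j = axis j 1"
    by metis
  define M :: "int ^ 3 ^ 3" where "M = (\<chi> i j. \<lfloor>g j $ i\<rfloor>)"
  have M: "map_matrix real_of_int M = (\<chi> i j. g j $ i)"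
    using g(1) by (simp add: M_def vec_eq_iff integer_lattice_def)
  have mult: "map_matrix real_of_int (A ** B) = map_matrix real_of_int A ** map_matrix real_of_int B"
    for A B :: "int ^ 3 ^ 3"
    by (simp add: matrix_matrix_mult_def vec_eq_iff)
  have one: "map_matrix real_of_int (mat 1) = (mat 1 :: real ^ 3 ^ 3)"
    by (simp add: mat_def vec_eq_iff)
  have inj: "A = B" if "map_matrix real_of_int A = map_matrix real_of_int B" for A B :: "int ^ 3 ^ 3"
    using that by (simp add: vec_eq_iff)
  have FM: "map_matrix real_of_int F ** map_matrix real_of_int M = mat 1"
  proof -
    have "(map_matrix real_of_int F ** map_matrix real_of_int M) $ i $ j = mat 1 $ i $ j" for i j
    proof -
      have "(map_matrix real_of_int F ** map_matrix real_of_int M) $ i $ j =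
          (map_matrix real_of_int F *v g j) $ i"
        by (simp add: M matrix_matrix_mult_def matrix_vector_mult_def)
      also have "\<dots> = mat 1 $ i $ j"
        unfolding g(2) by (simp add: axis_def mat_def)
      finally show ?thesis .
    qed
    then show ?thesis
      by (simp add: vec_eq_iff)
  qed
  then have MF: "map_matrix real_of_int M ** map_matrix real_of_int F = mat 1"
    using matrix_left_right_inverse by blast
  have "F ** M = mat 1" "M ** F = mat 1"
    by (rule inj; simp only: mult one FM MF)+
  then have "invertible M"
    unfolding invertible_def by blast
  moreover have "map_matrix real_of_int M *v f j = axis j 1" for j
  proof -
    have "f j = map_matrix real_of_int F *v axis j 1"
      by (simp add: F matrix_vector_mult_basis column_def vec_eq_iff)
    then have "map_matrix real_of_int M *v f j = (map_matrix real_of_int M ** map_matrix real_of_int F) *v axis j 1"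
      by (simp add: matrix_vector_mul_assoc)
    then show ?thesis
      by (simp add: MF)
  qed
  note this[of 1] this[of 2] this[of 3]
  ultimately show ?thesis
    unfolding f_simps by blast
qed

text \<open>The linear part maps the generators into \<open>ws\<close> up to sign; the translation
  \<open>- g s - t\<close> absorbs both the original offset and the one caused by sign
  changes.\<close>

lemma AGL_equivalent_multiples:
  fixes vs :: "(real ^ 'n) list" and M :: "int ^ 'n ^ 'n"
  assumes "invertible M" "s \<in> integer_lattice" "Z = {s} + zonotope vs" "directions vs \<subseteq> signed W"
    and W: "(\<lambda>x. map_matrix real_of_int M *v x) ` W \<subseteq> set ws" "set ws \<subseteq> integer_lattice"
  shows "\<exists>ns. length ns = length ws \<and>
    AGL_equivalent Z (sum_list (map2 (\<lambda>n w. n \<odot> closed_segment 0 w) ns ws))"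
proof -
  define g where "g x = map_matrix real_of_int M *v x" for x :: "real ^ 'n"
  have g: "linear g"
    unfolding g_def[abs_def] by (rule matrix_vector_mul_linear)
  have "g s \<in> integer_lattice"
    using assms(2) by (auto simp: g_def integer_lattice_def matrix_vector_mult_def intro!: Ints_sum)
  moreover have "set (map g vs) \<subseteq> signed (set ws)"
  proof
    fix y assume "y \<in> set (map g vs)"
    then obtain x where x: "x \<in> directions vs" "y = g x"
      by (auto simp: directions_def)
    have "g x \<in> set ws \<or> g (- x) \<in> set ws"
      using x(1) assms(4) W(1) unfolding signed_def g_def by blast
    then show "y \<in> signed (set ws)"
      using linear_neg[OF g, of x] by (simp add: signed_def x(2))
  qed
  then obtain t us where t: "t \<in> integer_lattice" "set us \<subseteq> set ws"
    "zonotope (map g vs) = {t} + zonotope us"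
    using zonotope_signed W(2) by blast
  moreover from t(2) obtain ns where ns: "length ns = length ws"
    "zonotope us = sum_list (map2 (\<lambda>n w. n \<odot> closed_segment 0 w) ns ws)"
    using zonotope_multiples by blast
  moreover have "(\<lambda>x. g x + (- g s - t)) ` Z = zonotope us"
  proof -
    have "(\<lambda>x. g x + (- g s - t)) ` ({s} + zonotope vs) = {- t} + g ` zonotope vs"
      using g by (simp add: singleton_plus_eq_image image_image linear_add)
    also have "\<dots> = {- t} + ({t} + zonotope us)"
      by (simp only: t(3) linear_image_zonotope[OF g])
    finally show ?thesis
      by (simp only: assms(3) singleton_plus_singleton) simp
  qed
  ultimately have "AGL_equivalent Z (sum_list (map2 (\<lambda>n w. n \<odot> closed_segment 0 w) ns ws))"
    using assms(1) unfolding AGL_equivalent_def affine_unimodular_def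
    by (intro exI[of _ "\<lambda>x. g x + (- g s - t)"] conjI exI[of _ M] exI[of _ "- g s - t"])
       (simp_all add: g_def[abs_def])
  then show ?thesis
    using ns(1) by blast
qed

lemma length_7_E:
  assumes "length ns = 7"
  obtains n1 n2 n3 n4 n5 n6 n7 where "ns = [n1, n2, n3, n4, n5, n6, n7]"
  using assms by (auto simp: numeral_eq_Suc length_Suc_conv)

theorem theorem2p5:
  fixes P :: "(real ^ 3) set" and A :: "real ^ 3" and Qs :: "(real ^ 3) set list"
  assumes "lattice_polytope P"
    and "smallest_maximal_decomposition P A Qs"
  shows "\<exists>n1 n2 n3 n4 n5 n6 n7 :: nat.
     AGL_equivalent (decomposition_sum A Qs)
       (n1 \<odot> closed_segment 0 e1 + n2 \<odot> closed_segment 0 e2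
        + n3 \<odot> closed_segment 0 (e1 + e2 + 2 *\<^sub>R e3)
        + n4 \<odot> closed_segment 0 (e1 + e2 + e3)
        + n5 \<odot> closed_segment 0 (e1 + e3) + n6 \<odot> closed_segment 0 (e2 + e3)
        + n7 \<odot> closed_segment 0 e3) \<or>
     (\<exists>w \<in> {e1 + e2, e1 - e2}.
       AGL_equivalent (decomposition_sum A Qs)
         (n1 \<odot> closed_segment 0 e1 + n2 \<odot> closed_segment 0 e2
          + n3 \<odot> closed_segment 0 e3
          + n4 \<odot> closed_segment 0 (e1 + e2 + e3)
          + n5 \<odot> closed_segment 0 w
          + n6 \<odot> closed_segment 0 (e1 + e3) + n7 \<odot> closed_segment 0 (e2 + e3)))"
proof -
  obtain s vs where vs: "s \<in> integer_lattice" "tight vs" "decomposition_sum A Qs = {s} + zonotope vs"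
    using smallest_decomposition_is_tight_zonotope[OF assms(2)] by blast
  obtain f1 f2 f3 where basis: "lattice_basis f1 f2 f3"
    and form: "directions vs \<subseteq> signed {f1, f2, f1 + f2 + 2 *\<^sub>R f3, f1 + f2 + f3, f1 + f3, f2 + f3, f3} \<or>
     (\<exists>w \<in> {f1 + f2, f1 - f2}. directions vs \<subseteq> signed (second_form f1 f2 f3 w))"
    using rigid_directions.classification[OF rigid_directions_tight[OF vs(2)]] by blast
  obtain M :: "int ^ 3 ^ 3" where M: "invertible M" "map_matrix real_of_int M *v f1 = e1"
    "map_matrix real_of_int M *v f2 = e2" "map_matrix real_of_int M *v f3 = e3"
    using lattice_basis_to_standard[OF basis] by blast
  note M_simps = M(2-4) matrix_vector_right_distrib matrix_vector_mult_diff_distrib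
    matrix_vector_mult_scaleR
  from form show ?thesis
  proof
    assume W: "directions vs \<subseteq> signed {f1, f2, f1 + f2 + 2 *\<^sub>R f3, f1 + f2 + f3, f1 + f3, f2 + f3, f3}"
    obtain ns where ns: "length ns = 7"
      "AGL_equivalent (decomposition_sum A Qs) (sum_list (map2 (\<lambda>n w. n \<odot> closed_segment 0 w) ns
         [e1, e2, e1 + e2 + 2 *\<^sub>R e3, e1 + e2 + e3, e1 + e3, e2 + e3, e3]))"
      using AGL_equivalent_multiples[OF M(1) vs(1,3) W,
          of "[e1, e2, e1 + e2 + 2 *\<^sub>R e3, e1 + e2 + e3, e1 + e3, e2 + e3, e3]"]
      by (auto simp: M_simps numeral_eq_Suc)
    obtain n1 n2 n3 n4 n5 n6 n7 where "ns = [n1, n2, n3, n4, n5, n6, n7]"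
      using ns(1) by (rule length_7_E)
    then have "AGL_equivalent (decomposition_sum A Qs)
       (n1 \<odot> closed_segment 0 e1 + n2 \<odot> closed_segment 0 e2
        + n3 \<odot> closed_segment 0 (e1 + e2 + 2 *\<^sub>R e3)
        + n4 \<odot> closed_segment 0 (e1 + e2 + e3)
        + n5 \<odot> closed_segment 0 (e1 + e3) + n6 \<odot> closed_segment 0 (e2 + e3)
        + n7 \<odot> closed_segment 0 e3)"
      using ns(2) by (simp add: add.assoc)
    then show ?thesis
      by blast
  next
    assume "\<exists>w \<in> {f1 + f2, f1 - f2}. directions vs \<subseteq> signed (second_form f1 f2 f3 w)"
    then obtain w where w: "w \<in> {f1 + f2, f1 - f2}" and W: "directions vs \<subseteq> signed (second_form f1 f2 f3 w)"
      by blast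
    \<comment> \<open>The linear map carries \<open>f1 + f2\<close> and \<open>f1 - f2\<close> to
      \<open>e1 + e2\<close> and \<open>e1 - e2\<close>, so the choice of sign is preserved.\<close>
    define w' where "w' = map_matrix real_of_int M *v w"
    have w': "w' \<in> {e1 + e2, e1 - e2}"
      using w by (auto simp: w'_def M_simps)
    then have w'_lat: "w' \<in> integer_lattice"
      by auto
    obtain ns where ns: "length ns = 7"
      "AGL_equivalent (decomposition_sum A Qs) (sum_list (map2 (\<lambda>n w. n \<odot> closed_segment 0 w) ns
         [e1, e2, e3, e1 + e2 + e3, w', e1 + e3, e2 + e3]))"
      using AGL_equivalent_multiples[OF M(1) vs(1,3) W,
          of "[e1, e2, e3, e1 + e2 + e3, w', e1 + e3, e2 + e3]"] w'_lat
      by (auto simp: M_simps second_form_def w'_def[symmetric] numeral_eq_Suc)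
    obtain n1 n2 n3 n4 n5 n6 n7 where "ns = [n1, n2, n3, n4, n5, n6, n7]"
      using ns(1) by (rule length_7_E)
    then have "AGL_equivalent (decomposition_sum A Qs)
         (n1 \<odot> closed_segment 0 e1 + n2 \<odot> closed_segment 0 e2
          + n3 \<odot> closed_segment 0 e3
          + n4 \<odot> closed_segment 0 (e1 + e2 + e3)
          + n5 \<odot> closed_segment 0 w'
          + n6 \<odot> closed_segment 0 (e1 + e3) + n7 \<odot> closed_segment 0 (e2 + e3))"
      using ns(2) by (simp add: add.assoc)
    then show ?thesis
      using w' by blast
  qed
qed

end
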